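(* Let $P_K$ be an almost canonical projection pattern with hull $\Omega$. Then its frequency module $\mathrm{freq}(\Omega)$ is a finitely generated abelian group.
   Context: Let $\Gamma\subset\mathbb{R}^n\times\mathbb{R}^{n^\perp}$ be a lattice (of rank $n+n^\perp$), $\pi^\|$ and $\pi^\perp$ the projections onto $\mathbb{R}^n$ and $\mathbb{R}^{n^\perp}$, and $K\subset\mathbb{R}^{n^\perp}$ a compact polyhedron (the window). Assume: the restrictions of $\pi^\|$ and $\pi^\perp$ to $\Gamma$ are injective with dense images; there is a finite set of affine hyperplanes $\{W_i\}_{i\in I}$ of codimension one in $\mathbb{R}^{n^\perp}$ such that $S:=\bigcup_{\gamma\in\Gamma}(\partial K-\pi^\perp(\gamma))=\bigcup_{i\in I}\bigcup_{\gamma\in\Gamma}(W_i-\pi^\perp(\gamma))$; and $0\notin S$. Then $P_K=\{\pi^\|(\gamma):\gamma\in\Gamma,\ \pi^\perp(\gamma)\in K\}$ is a repetitive Delone set, called an almost canonical projection pattern; $\Omega$ is its hull (all Delone sets locally indistinguishable from $P_K$ up to translation, with the usual local topology), on which $\mathbb{R}^n$ acts minimally and uniquely ergodically. The frequency of a finite patch $P$ is the density in $\mathbb{R}^n$ of the set of occurrences of translates of $P$ in $P_K$, and $\mathrm{freq}(\Omega)$ is the subgroup of $\mathbb{R}$ generated by the frequencies of all finite patches. *)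

theory Defs
  imports "HOL-Analysis.Analysis"
begin

definition is_lattice :: "'a::euclidean_space set \<Rightarrow> bool" where
  "is_lattice \<Gamma> \<longleftrightarrow> (\<exists>B. independent B \<and> span B = UNIV \<and>
      \<Gamma> = {\<Sum>b\<in>B. of_int (c b) *\<^sub>R b | c. True})"

definition compact_polyhedron :: "'a::euclidean_space set \<Rightarrow> bool" where
  "compact_polyhedron K \<longleftrightarrow>
     (\<exists>\<F>. finite \<F> \<and> (\<forall>P\<in>\<F>. polytope P) \<and> K = \<Union>\<F>)"

definition sing_set :: "('n::euclidean_space \<times> 'm::euclidean_space) set \<Rightarrow> 'm set \<Rightarrow> 'm set" where
  "sing_set \<Gamma> K = (\<Union>\<gamma>\<in>\<Gamma>. (\<lambda>x. x - snd \<gamma>) ` frontier K)"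

definition almost_canonical ::
  "('n::euclidean_space \<times> 'm::euclidean_space) set \<Rightarrow> 'm set \<Rightarrow> bool" where
  "almost_canonical \<Gamma> K \<longleftrightarrow>
     is_lattice \<Gamma> \<and>
     inj_on fst \<Gamma> \<and> inj_on snd \<Gamma> \<and>
     closure (fst ` \<Gamma>) = UNIV \<and> closure (snd ` \<Gamma>) = UNIV \<and>
     compact_polyhedron K \<and>
     (\<exists>W::('m \<times> real) set. finite W \<and> (\<forall>(a,b)\<in>W. a \<noteq> 0) \<and>
        sing_set \<Gamma> K =
          (\<Union>(a,b)\<in>W. \<Union>\<gamma>\<in>\<Gamma>. (\<lambda>x. x - snd \<gamma>) ` {x. a \<bullet> x = b})) \<and>
     0 \<notin> sing_set \<Gamma> K"

definition proj_pattern ::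
  "('n::euclidean_space \<times> 'm::euclidean_space) set \<Rightarrow> 'm set \<Rightarrow> 'n set" where
  "proj_pattern \<Gamma> K = {fst \<gamma> | \<gamma>. \<gamma> \<in> \<Gamma> \<and> snd \<gamma> \<in> K}"

definition density :: "'n::euclidean_space set \<Rightarrow> real" where
  "density A = Lim at_top
     (\<lambda>R::real. real (card (A \<inter> ball 0 R)) / measure lborel (ball (0::'n) R))"

definition patches :: "'n::euclidean_space set \<Rightarrow> (real \<times> 'n set) set" where
  "patches X = {(r, (\<lambda>y. y - x) ` X \<inter> cball 0 r) | r x. r \<ge> 0 \<and> x \<in> X}"

definition occurrences :: "'n::euclidean_space set \<Rightarrow> real \<Rightarrow> 'n set \<Rightarrow> 'n set" where
  "occurrences X r P = {t \<in> X. (\<lambda>y. y - t) ` X \<inter> cball 0 r = P}"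

definition frequencies :: "'n::euclidean_space set \<Rightarrow> real set" where
  "frequencies X = {density (occurrences X r P) | r P. (r, P) \<in> patches X}"

definition subgroup_generated :: "real set \<Rightarrow> real set" where
  "subgroup_generated A =
     \<Inter>{G. A \<subseteq> G \<and> 0 \<in> G \<and> (\<forall>x\<in>G. \<forall>y\<in>G. x + y \<in> G \<and> - x \<in> G)}"

definition freq_module :: "'n::euclidean_space set \<Rightarrow> real set" where
  "freq_module X = subgroup_generated (frequencies X)"

definition finitely_generated :: "real set \<Rightarrow> bool" where
  "finitely_generated G \<longleftrightarrow> (\<exists>F. finite F \<and> G = subgroup_generated F)"

end

theory Submission
  imports Defs "HOL-Real_Asymp.Real_Asymp"
begin

text \<open>
  The occurrences of a patch are the lattice points whose internal coordinate lies in an acceptance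
  domain, and this domain is a finite disjoint union of cells \<open>l h < a h \<bullet> y \<le> u h\<close>. The normals
  \<open>a h\<close> are the finitely many face normals of the window, whatever the patch, and the offsets
  \<open>l h\<close>, \<open>u h\<close> lie in a fixed finitely generated group. By equidistribution a cell contributes its
  volume divided by the covolume. The volume of a cell is a piecewise polynomial function of the
  offsets (integrate out one coordinate at a time), with finitely many pieces because the normals are
  fixed, so all frequencies lie in one finitely generated group, and \<open>\<int>\<close> is Noetherian.
\<close>

text \<open>The obstacle is uniformity: the patch radius is unbounded, so the number of cells and of
  possible offsets is unbounded too. What stays bounded is the number of arguments of the volume
  function, one lower and one upper offset per element of \<open>H\<close>, so one function serves
  every cell of every patch. On arguments from a group with finite generating set \<open>C\<close>,
  a polynomial takes values in the group generated by its coefficients times products of boundedly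
  many elements of \<open>C\<close>. This set is finite whatever the coefficients are, so arbitrary
  real normals and the factors 1/(k+1) produced by integration do no harm. The pieces are never
  enumerated: indicators of affine inequalities, with values 0 and 1, are treated as further
  factors. Equidistribution is obtained without Fourier analysis or an ergodic theorem.\<close>

subsection \<open>Finitely generated subgroups of the reals\<close>

definition add_subgroup :: "real set \<Rightarrow> bool" where
  "add_subgroup G \<longleftrightarrow> 0 \<in> G \<and> (\<forall>x\<in>G. \<forall>y\<in>G. x + y \<in> G \<and> - x \<in> G)"

lemma subgroup_generated_eq_Inter:
  "subgroup_generated A = \<Inter>{G. A \<subseteq> G \<and> add_subgroup G}"
  by (simp add: subgroup_generated_def add_subgroup_def)

lemma add_subgroup_subgroup_generated [simp]: "add_subgroup (subgroup_generated A)"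
  unfolding add_subgroup_def
proof (intro conjI ballI)
  show "0 \<in> subgroup_generated A" by (simp add: subgroup_generated_def)
  fix x y assume "x \<in> subgroup_generated A" "y \<in> subgroup_generated A"
  then show "x + y \<in> subgroup_generated A" "- x \<in> subgroup_generated A"
    unfolding subgroup_generated_def by blast+
qed

lemma subgroup_generated_superset: "A \<subseteq> subgroup_generated A"
  by (auto simp: subgroup_generated_eq_Inter)

lemma subgroup_generated_minimal:
  "A \<subseteq> G \<Longrightarrow> add_subgroup G \<Longrightarrow> subgroup_generated A \<subseteq> G"
  by (auto simp: subgroup_generated_eq_Inter)

lemma subgroup_generated_mono: "A \<subseteq> B \<Longrightarrow> subgroup_generated A \<subseteq> subgroup_generated B"
  using subgroup_generated_superset[of B] by (intro subgroup_generated_minimal) auto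

lemma subgroup_generated_inc: "x \<in> A \<Longrightarrow> x \<in> subgroup_generated A"
  using subgroup_generated_superset by blast

lemma add_subgroupD:
  assumes "add_subgroup G"
  shows "0 \<in> G" "x \<in> G \<Longrightarrow> y \<in> G \<Longrightarrow> x + y \<in> G" "x \<in> G \<Longrightarrow> - x \<in> G"
    "x \<in> G \<Longrightarrow> y \<in> G \<Longrightarrow> x - y \<in> G"
proof -
  from assms show "0 \<in> G" and add: "x \<in> G \<Longrightarrow> y \<in> G \<Longrightarrow> x + y \<in> G"
    and "x \<in> G \<Longrightarrow> - x \<in> G" for x y
    unfolding add_subgroup_def by blast+
  then show "x \<in> G \<Longrightarrow> y \<in> G \<Longrightarrow> x - y \<in> G"
    by (metis diff_conv_add_uminus)
qed

lemma add_subgroup_sum: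
  assumes "add_subgroup G" "\<And>i. i \<in> I \<Longrightarrow> f i \<in> G"
  shows "sum f I \<in> G"
  using assms(2) by (induction I rule: infinite_finite_induct) (auto intro: add_subgroupD[OF assms(1)])

lemma add_subgroup_of_int_mult:
  assumes "add_subgroup G" "x \<in> G"
  shows "of_int k * x \<in> G"
proof (induction k rule: int_induct[where k = 0])
  case (step1 i)
  then show ?case using add_subgroupD(2)[OF assms(1) _ assms(2), of "of_int i * x"]
    by (simp add: algebra_simps)
next
  case (step2 i)
  then show ?case using add_subgroupD(4)[OF assms(1) _ assms(2), of "of_int i * x"]
    by (simp add: algebra_simps)
qed (use add_subgroupD[OF assms(1)] in auto)

text \<open>Splits off one generator; the integers \<open>k\<close> that occur for elements of a
  given subgroup are what the Noetherian induction collects into an ideal.\<close>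

lemma subgroup_generated_insert:
  assumes "z \<in> subgroup_generated (insert a A)"
  obtains k :: int and g where "g \<in> subgroup_generated A" "z = of_int k * a + g"
proof -
  let ?G = "{of_int k * a + g | (k::int) g. g \<in> subgroup_generated A}"
  note S = add_subgroupD[OF add_subgroup_subgroup_generated[of A]]
  have "add_subgroup ?G"
    unfolding add_subgroup_def
  proof (intro conjI ballI)
    show "0 \<in> ?G" using S(1) by (auto intro!: exI[of _ 0])
  next
    fix x y assume "x \<in> ?G" "y \<in> ?G"
    then obtain k l :: int and g h where
      "x = of_int k * a + g" "y = of_int l * a + h"
      and gh: "g \<in> subgroup_generated A" "h \<in> subgroup_generated A" by blast
    then have "x + y = of_int (k + l) * a + (g + h)" "- x = of_int (- k) * a + (- g)"
      by (simp_all add: algebra_simps)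
    then show "x + y \<in> ?G" "- x \<in> ?G" using gh S by blast+
  qed
  moreover have "insert a A \<subseteq> ?G"
  proof -
    have "a = of_int 1 * a + 0" by simp
    then have "a \<in> ?G" using S(1) by blast
    moreover have "x \<in> ?G" if "x \<in> A" for x
    proof -
      have "x = of_int 0 * a + x" by simp
      then show ?thesis using subgroup_generated_inc[OF that] by blast
    qed
    ultimately show ?thesis by blast
  qed
  ultimately have "z \<in> ?G" using subgroup_generated_minimal assms by blast
  with that show ?thesis by blast
qed

lemma subgroup_generated_empty: "subgroup_generated {} = {0}"
proof
  show "subgroup_generated {} \<subseteq> {0}"
    by (rule subgroup_generated_minimal) (auto simp: add_subgroup_def)
  show "{0} \<subseteq> subgroup_generated {}"
    using add_subgroupD(1)[OF add_subgroup_subgroup_generated] by simp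
qed

text \<open>The least positive element divides all others, since a remainder modulo it lies in
  \<open>Z\<close> again and would be smaller.\<close>

lemma int_subgroup_principal:
  fixes Z :: "int set"
  assumes 0: "0 \<in> Z" and diff: "\<And>x y. x \<in> Z \<Longrightarrow> y \<in> Z \<Longrightarrow> x - y \<in> Z"
  obtains d where "d \<in> Z" "\<And>x. x \<in> Z \<Longrightarrow> d dvd x"
proof (cases "Z = {0}")
  case True
  then show ?thesis using that[of 0] by simp
next
  case False
  have neg: "- x \<in> Z" if "x \<in> Z" for x using diff[OF 0 that] by simp
  have add: "x + y \<in> Z" if "x \<in> Z" "y \<in> Z" for x y using diff[OF that(1) neg[OF that(2)]] by simp
  have mult_nat: "int k * x \<in> Z" if "x \<in> Z" for x k
    by (induction k) (use 0 add that in \<open>auto simp: algebra_simps\<close>)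
  have mult: "k * x \<in> Z" if "x \<in> Z" for x k
    using mult_nat[OF that] mult_nat[OF neg[OF that]]
    by (cases k rule: int_cases2) (metis, metis minus_mult_commute)
  from False 0 obtain x where x: "x \<in> Z" "x \<noteq> 0" by blast
  define P where "P n \<longleftrightarrow> 0 < n \<and> int n \<in> Z" for n
  have "P (nat \<bar>x\<bar>)" using x neg by (auto simp: P_def abs_if)
  then have d: "P (LEAST n. P n)" by (rule LeastI)
  define d where "d = (LEAST n. P n)"
  have d: "0 < d" "int d \<in> Z" using d by (auto simp: d_def P_def)
  have "int d dvd y" if "y \<in> Z" for y
  proof (rule ccontr)
    assume "\<not> int d dvd y"
    then have pos: "0 < y mod int d" using d by (metis dvd_eq_mod_eq_0 of_nat_0_less_iff pos_mod_sign order_le_less)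
    have "y mod int d = y - (y div int d) * int d" by (simp add: minus_div_mult_eq_mod)
    then have "y mod int d \<in> Z" using diff[OF that mult[OF d(2)]] by simp
    with pos have "P (nat (y mod int d))" by (simp add: P_def)
    then have "d \<le> nat (y mod int d)" unfolding d_def by (rule Least_le)
    then show False using pos_mod_bound[of "int d" y] d by linarith
  qed
  with d show ?thesis using that by blast
qed

text \<open>Induction on the generators: the coefficients of \<open>a\<close> occurring in
  \<open>G\<close> form an ideal with generator \<open>d\<close>, and one element of
  \<open>G\<close> with coefficient \<open>d\<close> together with generators of
  \<open>G \<inter> subgroup_generated F\<close> generates \<open>G\<close>.\<close>

lemma subgroup_of_finitely_generated:
  assumes "finite F" "add_subgroup G" "G \<subseteq> subgroup_generated F"
  shows "finitely_generated G"
  using assms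
proof (induction F arbitrary: G rule: finite_induct)
  case empty
  then have "G = subgroup_generated {}"
    using add_subgroupD(1)[OF empty(1)] by (auto simp: subgroup_generated_empty)
  then show ?case unfolding finitely_generated_def by blast
next
  case (insert a F)
  note S = add_subgroupD[OF add_subgroup_subgroup_generated[of F]]
  note G = add_subgroupD[OF insert.prems(1)]
  have "add_subgroup (G \<inter> subgroup_generated F)"
    using G S by (simp add: add_subgroup_def)
  from insert.IH[OF this] obtain F' where F': "finite F'" "G \<inter> subgroup_generated F = subgroup_generated F'"
    unfolding finitely_generated_def by blast
  define Z where "Z = {k::int. \<exists>g\<in>subgroup_generated F. of_int k * a + g \<in> G}"
  have Z0: "0 \<in> Z" using S(1) G(1) by (auto simp: Z_def intro!: bexI[of _ 0])
  have Zd: "k - l \<in> Z" if "k \<in> Z" "l \<in> Z" for k l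
  proof -
    from that obtain g h where gh: "g \<in> subgroup_generated F" "h \<in> subgroup_generated F"
      "of_int k * a + g \<in> G" "of_int l * a + h \<in> G" by (auto simp: Z_def)
    have "of_int (k - l) * a + (g - h) = (of_int k * a + g) - (of_int l * a + h)"
      by (simp add: algebra_simps)
    moreover have "(of_int k * a + g) - (of_int l * a + h) \<in> G" using gh(3,4) by (rule G(4))
    ultimately have "of_int (k - l) * a + (g - h) \<in> G" by (simp only:)
    then show ?thesis using S(4)[OF gh(1,2)] unfolding Z_def by blast
  qed
  obtain d where d: "d \<in> Z" "\<And>k. k \<in> Z \<Longrightarrow> d dvd k"
    using int_subgroup_principal[OF Z0 Zd] by blast
  from d(1) obtain g0 where g0: "g0 \<in> subgroup_generated F" "of_int d * a + g0 \<in> G"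
    by (auto simp: Z_def)
  define w where "w = of_int d * a + g0"
  let ?H = "subgroup_generated (insert w F')"
  note H = add_subgroupD[OF add_subgroup_subgroup_generated[of "insert w F'"]]
  have "?H \<subseteq> G"
    using F'(2) g0 subgroup_generated_superset[of F'] insert.prems
    by (intro subgroup_generated_minimal) (auto simp: w_def)
  moreover have "G \<subseteq> ?H"
  proof
    fix z assume z: "z \<in> G"
    with insert.prems obtain k g where kg: "g \<in> subgroup_generated F" "z = of_int k * a + g"
      using subgroup_generated_insert by blast
    with z have "k \<in> Z" by (auto simp: Z_def)
    with d obtain q where q: "k = d * q" by (auto elim: dvdE)
    have eq: "z - of_int q * w = g - of_int q * g0" using q kg by (simp add: w_def algebra_simps)
    have "z - of_int q * w \<in> G"
      using z g0 insert.prems(1) by (intro G(4) add_subgroup_of_int_mult) (auto simp: w_def)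
    moreover have "g - of_int q * g0 \<in> subgroup_generated F"
      using kg g0 by (intro S(4) add_subgroup_of_int_mult) auto
    ultimately have "z - of_int q * w \<in> subgroup_generated F'" using eq F'(2) by auto
    then have "z - of_int q * w \<in> ?H" using subgroup_generated_mono by blast
    moreover have "of_int q * w \<in> ?H"
      by (intro add_subgroup_of_int_mult subgroup_generated_inc) auto
    ultimately show "z \<in> ?H" using H(2) by fastforce
  qed
  ultimately have "G = ?H" by blast
  then show ?case using F'(1) unfolding finitely_generated_def by blast
qed

text \<open>With one factor fixed, the admissible other factors form a subgroup; applying this to
  each side in turn extends the claim from generators to all elements.\<close>

lemma subgroup_generated_mult:
  assumes "x \<in> subgroup_generated A" "y \<in> subgroup_generated B"
  shows "x * y \<in> subgroup_generated ((\<lambda>(a, b). a * b) ` (A \<times> B))"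
proof -
  let ?P = "subgroup_generated ((\<lambda>(a, b). a * b) ` (A \<times> B))"
  note P = add_subgroupD[OF add_subgroup_subgroup_generated[of "(\<lambda>(a, b). a * b) ` (A \<times> B)"]]
  have 1: "a * y \<in> ?P" if "a \<in> A" "y \<in> subgroup_generated B" for a y
  proof -
    have "B \<subseteq> {y. a * y \<in> ?P}" using that by (auto intro!: subgroup_generated_inc)
    moreover have "add_subgroup {y. a * y \<in> ?P}"
      using P by (simp add: add_subgroup_def algebra_simps)
    ultimately show ?thesis using subgroup_generated_minimal that(2) by blast
  qed
  have "A \<subseteq> {x. x * y \<in> ?P}" using 1 assms(2) by blast
  moreover have "add_subgroup {x. x * y \<in> ?P}"
    using P by (simp add: add_subgroup_def algebra_simps)
  ultimately show ?thesis using subgroup_generated_minimal assms(1) by blast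
qed

subsection \<open>Piecewise polynomial functions\<close>

inductive affine_form :: "(('v \<Rightarrow> real) \<Rightarrow> real) \<Rightarrow> bool" where
  affine_form_const: "affine_form (\<lambda>v. c)"
| affine_form_var: "affine_form (\<lambda>v. v i)"
| affine_form_add: "affine_form f \<Longrightarrow> affine_form g \<Longrightarrow> affine_form (\<lambda>v. f v + g v)"
| affine_form_scale: "affine_form f \<Longrightarrow> affine_form (\<lambda>v. c * f v)"

lemma affine_form_uminus: "affine_form f \<Longrightarrow> affine_form (\<lambda>v. - f v)"
  using affine_form_scale[of f "-1"] by simp

lemma affine_form_diff: "affine_form f \<Longrightarrow> affine_form g \<Longrightarrow> affine_form (\<lambda>v. f v - g v)"
  using affine_form_add[OF _ affine_form_uminus, of f g] by simp

lemma affine_form_sum: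
  "(\<And>i. i \<in> I \<Longrightarrow> affine_form (f i)) \<Longrightarrow> affine_form (\<lambda>v. \<Sum>i\<in>I. f i v)"
  by (induction I rule: infinite_finite_induct)
    (auto intro: affine_form_const affine_form_add)

definition indep_var :: "'v \<Rightarrow> (('v \<Rightarrow> real) \<Rightarrow> real) \<Rightarrow> bool" where
  "indep_var i f \<longleftrightarrow> (\<forall>v t. f (v(i := t)) = f v)"

lemma affine_form_split:
  assumes "affine_form f"
  obtains \<alpha> g where "affine_form g" "indep_var i g" "\<And>v. f v = \<alpha> * v i + g v"
proof -
  from assms have "\<exists>\<alpha> g. affine_form g \<and> indep_var i g \<and> (\<forall>v. f v = \<alpha> * v i + g v)"
  proof induction
    case (affine_form_const c)
    show ?case by (rule exI[of _ 0], rule exI[of _ "\<lambda>_. c"])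
      (simp add: indep_var_def affine_form.affine_form_const)
  next
    case (affine_form_var j)
    show ?case
    proof (cases "i = j")
      case True
      then show ?thesis by (intro exI[of _ 1] exI[of _ "\<lambda>_. 0"])
        (simp add: indep_var_def affine_form.affine_form_const)
    next
      case False
      then show ?thesis by (intro exI[of _ 0] exI[of _ "\<lambda>v. v j"])
        (simp add: indep_var_def affine_form.affine_form_var)
    qed
  next
    case (affine_form_add f g)
    then obtain \<alpha> f' \<beta> g' where *: "affine_form f'" "indep_var i f'" "\<forall>v. f v = \<alpha> * v i + f' v"
      "affine_form g'" "indep_var i g'" "\<forall>v. g v = \<beta> * v i + g' v" by blast
    then show ?case by (intro exI[of _ "\<alpha> + \<beta>"] exI[of _ "\<lambda>v. f' v + g' v"])
      (simp add: indep_var_def affine_form.affine_form_add algebra_simps)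
  next
    case (affine_form_scale f c)
    then obtain \<alpha> f' where *: "affine_form f'" "indep_var i f'" "\<forall>v. f v = \<alpha> * v i + f' v" by blast
    then show ?case by (intro exI[of _ "c * \<alpha>"] exI[of _ "\<lambda>v. c * f' v"])
      (simp add: indep_var_def affine_form.affine_form_scale algebra_simps)
  qed
  with that show ?thesis by blast
qed

text \<open>Only affine conditions may stand inside an indicator. Solving such a condition for one
  variable gives an affine threshold in the remaining ones, which is what keeps the class closed
  under integration.\<close>

inductive pw_poly :: "(('v \<Rightarrow> real) \<Rightarrow> real) \<Rightarrow> bool" where
  pw_poly_const: "pw_poly (\<lambda>v. c)"
| pw_poly_var: "pw_poly (\<lambda>v. v i)"
| pw_poly_add: "pw_poly f \<Longrightarrow> pw_poly g \<Longrightarrow> pw_poly (\<lambda>v. f v + g v)"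
| pw_poly_mult: "pw_poly f \<Longrightarrow> pw_poly g \<Longrightarrow> pw_poly (\<lambda>v. f v * g v)"
| pw_poly_nonneg: "affine_form f \<Longrightarrow> pw_poly (\<lambda>v. of_bool (0 \<le> f v))"

lemma pw_poly_diff: "pw_poly f \<Longrightarrow> pw_poly g \<Longrightarrow> pw_poly (\<lambda>v. f v - g v)"
  using pw_poly_add[OF _ pw_poly_mult[OF pw_poly_const[of "-1"]], of f g] by simp

lemma pw_poly_affine: "affine_form f \<Longrightarrow> pw_poly f"
  by (induction rule: affine_form.induct) (auto intro: pw_poly.intros)

lemma pw_poly_power: "pw_poly f \<Longrightarrow> pw_poly (\<lambda>v. f v ^ k)"
  by (induction k) (auto intro: pw_poly.intros)

lemma pw_poly_prod: "(\<And>i. i \<in> I \<Longrightarrow> pw_poly (f i)) \<Longrightarrow> pw_poly (\<lambda>v. \<Prod>i\<in>I. f i v)"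
  by (induction I rule: infinite_finite_induct) (auto intro: pw_poly.intros)

lemma pw_poly_le:
  assumes "affine_form f" "affine_form g"
  shows "pw_poly (\<lambda>v. of_bool (f v \<le> g v))"
  using pw_poly_nonneg[OF affine_form_diff[OF assms(2,1)]] by simp

lemma pw_poly_less:
  assumes "affine_form f" "affine_form g"
  shows "pw_poly (\<lambda>v. of_bool (f v < g v))"
proof -
  have "(\<lambda>v. of_bool (f v < g v)) = (\<lambda>v. 1 - of_bool (g v \<le> f v) :: real)"
    by (auto simp: fun_eq_iff)
  then show ?thesis using pw_poly_diff[OF pw_poly_const pw_poly_le[OF assms(2,1)]] by simp
qed

lemma pw_poly_eq:
  assumes "affine_form f" "affine_form g"
  shows "pw_poly (\<lambda>v. of_bool (f v = g v))"
proof -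
  have "(\<lambda>v. of_bool (f v = g v)) = (\<lambda>v. of_bool (f v \<le> g v) * of_bool (g v \<le> f v) :: real)"
    by (auto simp: fun_eq_iff)
  then show ?thesis using pw_poly_mult[OF pw_poly_le[OF assms] pw_poly_le[OF assms(2,1)]] by simp
qed

lemma pw_poly_if:
  assumes "affine_form f" "affine_form g" "pw_poly p" "pw_poly q"
  shows "pw_poly (\<lambda>v. if f v \<le> g v then p v else q v)"
proof -
  have "(\<lambda>v. if f v \<le> g v then p v else q v) =
      (\<lambda>v. of_bool (f v \<le> g v) * p v + (1 - of_bool (f v \<le> g v)) * q v)"
    by (auto simp: fun_eq_iff)
  moreover have "pw_poly (\<lambda>v. of_bool (f v \<le> g v) * p v + (1 - of_bool (f v \<le> g v)) * q v)"
    by (intro pw_poly_add pw_poly_mult pw_poly_diff pw_poly_const pw_poly_le assms)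
  ultimately show ?thesis by simp
qed

text \<open>\<open>G\<close> is chosen before \<open>v\<close>, which is the uniformity needed
  later. A constant becomes a generator, an indicator needs only the generator 1, and a product is
  covered by the pairwise products of generators.\<close>

lemma pw_poly_values:
  assumes "pw_poly f" "finite C"
  shows "\<exists>G. finite G \<and> (\<forall>v. range v \<subseteq> subgroup_generated C \<longrightarrow> f v \<in> subgroup_generated G)"
  using assms(1)
proof induction
  case (pw_poly_const c)
  show ?case by (intro exI[of _ "{c}"]) (auto intro: subgroup_generated_inc)
next
  case (pw_poly_var i)
  show ?case using assms(2) by (intro exI[of _ C]) auto
next
  case (pw_poly_add f g)
  then obtain A B where "finite A" "finite B"
    "\<forall>v. range v \<subseteq> subgroup_generated C \<longrightarrow> f v \<in> subgroup_generated A"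
    "\<forall>v. range v \<subseteq> subgroup_generated C \<longrightarrow> g v \<in> subgroup_generated B" by blast
  then show ?case
    using subgroup_generated_mono[of A "A \<union> B"] subgroup_generated_mono[of B "A \<union> B"]
    by (intro exI[of _ "A \<union> B"]) (auto intro!: add_subgroupD(2))
next
  case (pw_poly_mult f g)
  then obtain A B where "finite A" "finite B"
    "\<forall>v. range v \<subseteq> subgroup_generated C \<longrightarrow> f v \<in> subgroup_generated A"
    "\<forall>v. range v \<subseteq> subgroup_generated C \<longrightarrow> g v \<in> subgroup_generated B" by blast
  then show ?case
    by (intro exI[of _ "(\<lambda>(a, b). a * b) ` (A \<times> B)"]) (auto intro: subgroup_generated_mult)
next
  case (pw_poly_nonneg f)
  show ?case
    using add_subgroupD(1)[OF add_subgroup_subgroup_generated, of "{1}"]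
    by (intro exI[of _ "{1}"]) (auto intro: subgroup_generated_inc)
qed

text \<open>The Boolean \<open>b\<close> decides the value of the step at its threshold; with this choice the product of
  two steps in \<open>v i\<close> is again a sum of single steps.\<close>
inductive var_normal :: "'v \<Rightarrow> (('v \<Rightarrow> real) \<Rightarrow> real) \<Rightarrow> bool" for i where
  var_normal_monom: "pw_poly g \<Longrightarrow> indep_var i g \<Longrightarrow> var_normal i (\<lambda>v. g v * v i ^ k)"
| var_normal_step: "pw_poly g \<Longrightarrow> indep_var i g \<Longrightarrow> affine_form l \<Longrightarrow> indep_var i l \<Longrightarrow>
    var_normal i (\<lambda>v. g v * v i ^ k * of_bool (l v < v i \<or> b \<and> l v = v i))"
| var_normal_add: "var_normal i f \<Longrightarrow> var_normal i g \<Longrightarrow> var_normal i (\<lambda>v. f v + g v)"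

lemma indep_var_simps: "indep_var i f \<Longrightarrow> f (v(i := t)) = f v"
  by (simp add: indep_var_def)

lemma indep_var_mult: "indep_var i f \<Longrightarrow> indep_var i g \<Longrightarrow> indep_var i (\<lambda>v. f v * g v)"
  by (simp add: indep_var_def)

lemma indep_var_of_bool:
  "indep_var i f \<Longrightarrow> indep_var i g \<Longrightarrow> indep_var i (\<lambda>v. of_bool (f v < g v))"
  "indep_var i f \<Longrightarrow> indep_var i g \<Longrightarrow> indep_var i (\<lambda>v. of_bool (f v = g v))"
  by (simp_all add: indep_var_def)

lemma var_normal_mult:
  assumes "var_normal i f" "var_normal i g"
  shows "var_normal i (\<lambda>v. f v * g v)"
  using assms
proof (induction arbitrary: g)
  case (var_normal_monom p k)
  note p = var_normal_monom
  from p(3) show ?case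
  proof induction
    case (var_normal_monom q m)
    have "(\<lambda>v. p v * v i ^ k * (q v * v i ^ m)) = (\<lambda>v. (p v * q v) * v i ^ (k + m))"
      by (simp add: fun_eq_iff power_add algebra_simps)
    then show ?case using p var_normal_monom
      by (auto intro!: var_normal.var_normal_monom pw_poly_mult indep_var_mult)
  next
    case (var_normal_step q l m b)
    have "(\<lambda>v. p v * v i ^ k * (q v * v i ^ m * of_bool (l v < v i \<or> b \<and> l v = v i)))
        = (\<lambda>v. (p v * q v) * v i ^ (k + m) * of_bool (l v < v i \<or> b \<and> l v = v i))"
      by (simp add: fun_eq_iff power_add algebra_simps)
    then show ?case using p var_normal_step
      by (simp only:) (intro var_normal.var_normal_step pw_poly_mult indep_var_mult)
  next
    case (var_normal_add f g)
    then show ?case unfolding distrib_left by (intro var_normal.var_normal_add)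
  qed
next
  case (var_normal_step p l k b)
  note p = var_normal_step
  from p(5) show ?case
  proof induction
    case (var_normal_monom q m)
    have "(\<lambda>v. p v * v i ^ k * of_bool (l v < v i \<or> b \<and> l v = v i) * (q v * v i ^ m))
        = (\<lambda>v. (p v * q v) * v i ^ (k + m) * of_bool (l v < v i \<or> b \<and> l v = v i))"
      by (simp add: fun_eq_iff power_add algebra_simps)
    then show ?case using p var_normal_monom
      by (simp only:) (intro var_normal.var_normal_step pw_poly_mult indep_var_mult)
  next
    case (var_normal_step q l' m b')
    let ?r = "\<lambda>v. p v * q v"
    \<comment> \<open>The larger threshold wins. Which one is larger does not depend on
      \<open>v i\<close>, so the comparison can join the coefficient; at a tie the threshold point
      survives only if both steps include it.\<close>
    have "(\<lambda>v. p v * v i ^ k * of_bool (l v < v i \<or> b \<and> l v = v i) *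
          (q v * v i ^ m * of_bool (l' v < v i \<or> b' \<and> l' v = v i)))
        = (\<lambda>v. (?r v * of_bool (l v < l' v)) * v i ^ (k + m) * of_bool (l' v < v i \<or> b' \<and> l' v = v i)
           + (?r v * of_bool (l' v < l v)) * v i ^ (k + m) * of_bool (l v < v i \<or> b \<and> l v = v i)
           + (?r v * of_bool (l v = l' v)) * v i ^ (k + m) * of_bool (l v < v i \<or> (b \<and> b') \<and> l v = v i))"
      by (auto simp add: fun_eq_iff power_add of_bool_def)
    then show ?case using p var_normal_step
      by (simp only:) (intro var_normal.var_normal_step var_normal.var_normal_add pw_poly_mult
          indep_var_mult indep_var_of_bool pw_poly_less pw_poly_eq)
  next
    case (var_normal_add f g)
    then show ?case unfolding distrib_left by (intro var_normal.var_normal_add)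
  qed
next
  case (var_normal_add f f')
  then show ?case unfolding distrib_right by (intro var_normal.var_normal_add)
qed

lemma indep_var_const: "indep_var i (\<lambda>v. c)"
  by (simp add: indep_var_def)

lemma var_normal_indep: "pw_poly g \<Longrightarrow> indep_var i g \<Longrightarrow> var_normal i g"
  using var_normal_monom[of g i 0] by simp

lemma pw_poly_var_normal:
  assumes "pw_poly f"
  shows "var_normal i f"
  using assms
proof induction
  case (pw_poly_const c)
  show ?case by (intro var_normal_indep pw_poly.pw_poly_const indep_var_const)
next
  case (pw_poly_var j)
  show ?case
  proof (cases "j = i")
    case True
    then show ?thesis using var_normal_monom[OF pw_poly_const[of 1] indep_var_const, of i 1] by simp
  next
    case False
    then show ?thesis by (intro var_normal_indep pw_poly.pw_poly_var) (simp add: indep_var_def)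
  qed
next
  case (pw_poly_add f g)
  then show ?case by (intro var_normal_add)
next
  case (pw_poly_mult f g)
  then show ?case by (intro var_normal_mult)
next
  case (pw_poly_nonneg f)
  obtain \<alpha> g where g: "affine_form g" "indep_var i g" "\<And>v. f v = \<alpha> * v i + g v"
    using affine_form_split[OF pw_poly_nonneg, where i = i] by blast
  \<comment> \<open>The zero of \<open>f\<close> as a function of \<open>v i\<close> when
    \<open>\<alpha>\<close> is nonzero.\<close>
  define l where "l v = (- 1 / \<alpha>) * g v" for v
  have l: "affine_form l" "indep_var i l"
    using g(1,2) unfolding l_def by (intro affine_form_scale, auto simp: indep_var_def)
  consider "\<alpha> = 0" | "\<alpha> > 0" | "\<alpha> < 0" by linarith
  then show ?case
  proof cases
    case 1
    then show ?thesis using g by (intro var_normal_indep pw_poly.pw_poly_nonneg pw_poly_nonneg)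
      (simp add: indep_var_def)
  next
    case 2
    then have "(\<lambda>v. of_bool (0 \<le> f v)) =
        (\<lambda>v. (\<lambda>_. 1) v * v i ^ 0 * of_bool (l v < v i \<or> True \<and> l v = v i) :: real)"
      by (auto simp: fun_eq_iff g(3) l_def of_bool_def field_simps)
    then show ?thesis using l
      by (simp only:) (intro var_normal_step pw_poly_const indep_var_const)
  next
    case 3
    \<comment> \<open>For negative slope the condition reads \<open>v i \<le> l v\<close>, the
      complement of a strict step: hence the leading 1 and the Boolean \<open>False\<close>.\<close>
    then have "(\<lambda>v. of_bool (0 \<le> f v)) =
        (\<lambda>v. 1 + (\<lambda>_. - 1) v * v i ^ 0 * of_bool (l v < v i \<or> False \<and> l v = v i) :: real)"
      by (auto simp: fun_eq_iff g(3) l_def of_bool_def field_simps)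
    then show ?thesis using l
      by (simp only:) (intro var_normal_add var_normal_step pw_poly_const indep_var_const
          var_normal_indep)
  qed
qed

text \<open>On a bounded interval a step merely raises the lower limit of integration, so each
  summand integrates to its coefficient times a difference of powers.\<close>

lemma var_normal_integral:
  assumes "var_normal i f" "lo \<le> hi"
  shows "(\<forall>v. integrable lborel (\<lambda>t. f (v(i := t)) * indicator {lo..hi} t)) \<and>
    pw_poly (\<lambda>v. \<integral>t. f (v(i := t)) * indicator {lo..hi} t \<partial>lborel)"
  using assms(1)
proof induction
  case (var_normal_monom g k)
  have eq: "(\<lambda>t. g (v(i := t)) * (v(i := t)) i ^ k * indicator {lo..hi} t) =
      (\<lambda>t. g v * (t ^ k * indicator {lo..hi} t))" for v
    using var_normal_monom(2) by (simp add: indep_var_simps fun_eq_iff)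
  have int: "integrable lborel (\<lambda>t. t ^ k * indicator {lo..hi} t)"
    using borel_integrable_compact[of "{lo..hi}" "\<lambda>t. t ^ k"]
    by (simp add: continuous_intros mult.commute)
  show ?case
    unfolding eq integral_mult_right_zero integral_power[OF assms(2)]
    using int pw_poly_mult[OF var_normal_monom(1) pw_poly_const]
    by (simp del: power_Suc times_divide_eq_right of_nat_Suc)
next
  case (var_normal_step g l k b)
  \<comment> \<open>The threshold clamped to the interval; beyond \<open>hi\<close> it leaves the
    single point \<open>hi\<close> and the integral is 0.\<close>
  let ?m = "\<lambda>v. if l v \<le> lo then lo else if hi \<le> l v then hi else l v"
  have eq: "(\<lambda>t. g (v(i := t)) * (v(i := t)) i ^ k *
        of_bool (l (v(i := t)) < (v(i := t)) i \<or> b \<and> l (v(i := t)) = (v(i := t)) i) * indicator {lo..hi} t) =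
      (\<lambda>t. g v * (t ^ k * of_bool (l v < t \<or> b \<and> l v = t) * indicator {lo..hi} t))" for v
    using var_normal_step by (simp add: indep_var_simps fun_eq_iff)
  have int: "integrable lborel (\<lambda>t. t ^ k * indicator {?m v..hi} t)" for v
    using borel_integrable_compact[of "{?m v..hi}" "\<lambda>t. t ^ k"]
    by (simp add: continuous_intros mult.commute)
  \<comment> \<open>The integrands can differ only at the threshold and at \<open>hi\<close>, which
    is why \<open>b\<close> does not appear in the value of the integral.\<close>
  have ae: "AE t in lborel. t ^ k * indicator {?m v..hi} t =
      t ^ k * of_bool (l v < t \<or> b \<and> l v = t) * indicator {lo..hi} t" for v
    using AE_lborel_singleton[of "l v"] AE_lborel_singleton[of hi]
    by eventually_elim (auto simp: indicator_def)
  have [measurable]: "(\<lambda>t. t ^ k * of_bool (l v < t \<or> b \<and> l v = t) * indicator {lo..hi} t) \<in> borel_measurable lborel" for v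
    by measurable
  have int': "integrable lborel (\<lambda>t. t ^ k * of_bool (l v < t \<or> b \<and> l v = t) * indicator {lo..hi} t)" for v
    using int ae by (subst integrable_cong_AE[symmetric, OF _ _ ae]) auto
  have val: "(\<integral>t. t ^ k * of_bool (l v < t \<or> b \<and> l v = t) * indicator {lo..hi} t \<partial>lborel) =
      (hi ^ Suc k - ?m v ^ Suc k) / Suc k" for v
    using integral_power[of "?m v" hi k] assms(2)
    by (subst integral_cong_AE[symmetric, OF _ _ ae]) auto
  have "pw_poly ?m"
    using var_normal_step(3)
    by (intro pw_poly_if affine_form_const pw_poly_const) (simp_all add: pw_poly_affine)
  then have "pw_poly (\<lambda>v. g v * ((hi ^ Suc k - ?m v ^ Suc k) * (1 / Suc k)))"
    using var_normal_step(1)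
    by (intro pw_poly_mult pw_poly_diff pw_poly_power pw_poly_const)
  then have pw: "pw_poly (\<lambda>v. g v * ((hi ^ Suc k - ?m v ^ Suc k) / Suc k))"
    by simp
  show ?case
    unfolding eq integral_mult_right_zero val
    using int' pw by auto
next
  case (var_normal_add f g)
  then show ?case by (auto simp: distrib_right intro: pw_poly_add)
qed

lemma pw_poly_integral_var:
  assumes "pw_poly f" "lo \<le> hi"
  shows "pw_poly (\<lambda>v. \<integral>t. f (v(i := t)) * indicator {lo..hi} t \<partial>lborel)"
  using var_normal_integral[OF pw_poly_var_normal[OF assms(1)] assms(2)] by blast

section \<open>Iterated integration over a box\<close>

definition merge_vars :: "'a set \<Rightarrow> ('a \<Rightarrow> real) \<Rightarrow> ('a + 'p \<Rightarrow> real) \<Rightarrow> 'a + 'p \<Rightarrow> real" where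
  "merge_vars I x v = (\<lambda>j. case j of Inl i \<Rightarrow> if i \<in> I then x i else v j | Inr p \<Rightarrow> v j)"

lemma affine_form_measurable:
  assumes "affine_form f" "finite I"
  shows "(\<lambda>x. f (merge_vars I x v)) \<in> borel_measurable (Pi\<^sub>M I (\<lambda>_. lborel))"
  using assms(1)
proof induction
  case (affine_form_var j)
  show ?case
  proof (cases "\<exists>i\<in>I. j = Inl i")
    case True
    then obtain i where "i \<in> I" "j = Inl i" by blast
    then show ?thesis by (simp add: merge_vars_def measurable_component_singleton)
  next
    case False
    then have "merge_vars I x v j = v j" for x by (auto simp: merge_vars_def split: sum.split)
    then show ?thesis by simp
  qed
qed auto

lemma pw_poly_measurable:
  assumes "pw_poly f" "finite I"
  shows "(\<lambda>x. f (merge_vars I x v)) \<in> borel_measurable (Pi\<^sub>M I (\<lambda>_. lborel))"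
  using assms(1)
proof induction
  case (pw_poly_var j)
  show ?case by (rule affine_form_measurable[OF affine_form_var assms(2)])
next
  case (pw_poly_nonneg f)
  note [measurable] = affine_form_measurable[OF pw_poly_nonneg assms(2)]
  show ?case by measurable
qed auto

lemma pw_poly_bounded:
  assumes "pw_poly f"
  shows "\<exists>B. \<forall>x. (\<forall>i\<in>I. \<bar>x i\<bar> \<le> r) \<longrightarrow> \<bar>f (merge_vars I x v)\<bar> \<le> B"
  using assms
proof induction
  case (pw_poly_var j)
  show ?case
    by (rule exI[of _ "max r \<bar>v j\<bar>"]) (auto simp: merge_vars_def split: sum.split)
next
  case (pw_poly_add f g)
  then obtain A B where "\<And>x. \<forall>i\<in>I. \<bar>x i\<bar> \<le> r \<Longrightarrow> \<bar>f (merge_vars I x v)\<bar> \<le> A"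
    "\<And>x. \<forall>i\<in>I. \<bar>x i\<bar> \<le> r \<Longrightarrow> \<bar>g (merge_vars I x v)\<bar> \<le> B" by blast
  then show ?case by (intro exI[of _ "A + B"]) (meson abs_triangle_ineq add_mono order_trans)
next
  case (pw_poly_mult f g)
  then obtain A B where "\<And>x. \<forall>i\<in>I. \<bar>x i\<bar> \<le> r \<Longrightarrow> \<bar>f (merge_vars I x v)\<bar> \<le> A"
    "\<And>x. \<forall>i\<in>I. \<bar>x i\<bar> \<le> r \<Longrightarrow> \<bar>g (merge_vars I x v)\<bar> \<le> B" by blast
  then show ?case
    by (intro exI[of _ "A * B"] allI impI) (simp add: abs_mult mult_mono' )
next
  case (pw_poly_nonneg f)
  show ?case by (rule exI[of _ 1]) auto
qed auto

lemma pw_poly_integrable: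
  assumes "pw_poly f" "finite I" "0 \<le> r"
  shows "integrable (Pi\<^sub>M I (\<lambda>_. lborel))
    (\<lambda>x. f (merge_vars I x v) * (\<Prod>i\<in>I. indicator {- r..r} (x i)))"
proof -
  interpret product_sigma_finite "\<lambda>_::'a. lborel :: real measure" ..
  obtain B where B: "\<And>x. \<forall>i\<in>I. \<bar>x i\<bar> \<le> r \<Longrightarrow> \<bar>f (merge_vars I x v)\<bar> \<le> B"
    using pw_poly_bounded[OF assms(1)] by blast
  have ind: "integrable (Pi\<^sub>M I (\<lambda>_. lborel)) (\<lambda>x. \<Prod>i\<in>I. indicator {- r..r} (x i) :: real)"
    using assms(2) by (intro product_integrable_prod) (auto simp: assms(3))
  show ?thesis
  proof (rule Bochner_Integration.integrable_bound[OF integrable_mult_right[OF ind, of B]])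
    show "(\<lambda>x. f (merge_vars I x v) * (\<Prod>i\<in>I. indicator {- r..r} (x i)))
        \<in> borel_measurable (Pi\<^sub>M I (\<lambda>_. lborel))"
      using pw_poly_measurable[OF assms(1,2)] borel_measurable_integrable[OF ind]
      by (rule borel_measurable_times)
    have "\<bar>f (merge_vars I x v) * (\<Prod>i\<in>I. indicator {- r..r} (x i))\<bar>
        \<le> \<bar>B * (\<Prod>i\<in>I. indicator {- r..r} (x i))\<bar>" for x
    proof (cases "\<forall>i\<in>I. \<bar>x i\<bar> \<le> r")
      case True
      then show ?thesis using B[OF True] by (simp add: abs_mult mult_right_mono)
    next
      case False
      then obtain i where "i \<in> I" "\<not> \<bar>x i\<bar> \<le> r" by blast
      then have "\<exists>i\<in>I. indicator {- r..r} (x i) = (0 :: real)"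
        by (intro bexI[of _ i]) (auto simp: indicator_def)
      then have "(\<Prod>i\<in>I. indicator {- r..r} (x i) :: real) = 0" using assms(2) by simp
      then show ?thesis by simp
    qed
    then show "AE x in Pi\<^sub>M I (\<lambda>_. lborel).
        norm (f (merge_vars I x v) * (\<Prod>i\<in>I. indicator {- r..r} (x i)))
        \<le> norm (B * (\<Prod>i\<in>I. indicator {- r..r} (x i)))" by simp
  qed
qed

text \<open>Variables \<open>Inl i\<close> are coordinates to be integrated out, variables
  \<open>Inr p\<close> are parameters. The newly inserted coordinate is integrated innermost; the
  result is in the class again, so the induction hypothesis, stated for arbitrary \<open>f\<close>,
  applies to it.\<close>

lemma pw_poly_integral_box:
  assumes "finite I" "pw_poly f" "0 \<le> r"
  shows "\<exists>g. pw_poly g \<and> (\<forall>v. g v =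
    (\<integral>x. f (merge_vars I x v) * (\<Prod>i\<in>I. indicator {- r..r} (x i)) \<partial>Pi\<^sub>M I (\<lambda>_. lborel)))"
  using assms(1,2)
proof (induction I arbitrary: f rule: finite_induct)
  case empty
  have "merge_vars {} x v = v" for x :: "'a \<Rightarrow> real" and v :: "'a + 'b \<Rightarrow> real"
    by (auto simp: merge_vars_def fun_eq_iff split: sum.split)
  then show ?case using empty by (intro exI[of _ f]) (simp add: PiM_empty lebesgue_integral_count_space_finite)
next
  case (insert i I)
  interpret product_sigma_finite "\<lambda>_::'a. lborel :: real measure" ..
  let ?h = "\<lambda>v. \<integral>t. f (v(Inl i := t)) * indicator {- r..r} t \<partial>lborel"
  have "pw_poly ?h" using insert.prems assms(3) by (intro pw_poly_integral_var) auto
  from insert.IH[OF this] obtain g where g: "pw_poly g" "\<And>v. g v =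
    (\<integral>x. ?h (merge_vars I x v) * (\<Prod>i\<in>I. indicator {- r..r} (x i)) \<partial>Pi\<^sub>M I (\<lambda>_. lborel))"
    by blast
  have "(\<integral>x. f (merge_vars (insert i I) x v) * (\<Prod>j\<in>insert i I. indicator {- r..r} (x j))
      \<partial>Pi\<^sub>M (insert i I) (\<lambda>_. lborel)) = g v" for v
  proof -
    have merge: "merge_vars (insert i I) (x(i := t)) v = (merge_vars I x v)(Inl i := t)" for x t
      by (auto simp: merge_vars_def fun_eq_iff split: sum.split)
    have prod: "(\<Prod>j\<in>insert i I. indicator {- r..r} ((x(i := t)) j)) =
        indicator {- r..r} t * (\<Prod>j\<in>I. indicator {- r..r} (x j) :: real)" for x t
      using insert.hyps by (simp add: prod.insert) (intro disjI2 prod.cong, auto)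
    have inner: "(\<integral>t. f (merge_vars (insert i I) (x(i := t)) v) *
        (\<Prod>j\<in>insert i I. indicator {- r..r} ((x(i := t)) j)) \<partial>lborel) =
        ?h (merge_vars I x v) * (\<Prod>i\<in>I. indicator {- r..r} (x i))" for x
      unfolding merge prod mult.assoc[symmetric] by simp
    show ?thesis
      unfolding g(2) product_integral_insert[OF insert.hyps
        pw_poly_integrable[OF insert.prems finite.insertI[OF insert.hyps(1)] assms(3)]] inner ..
  qed
  with g(1) show ?case by metis
qed

text \<open>Passes from the product measure to \<open>lborel\<close> by coordinates. The zeros fed
  to \<open>g\<close> are harmless: the variables \<open>Inl b\<close> with \<open>b\<close> in
  \<open>Basis\<close> have been integrated out, and the other \<open>Inl b\<close> are 0 on both
  sides.\<close>

lemma pw_poly_integral_cbox: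
  fixes f :: "('a::euclidean_space + 'p \<Rightarrow> real) \<Rightarrow> real"
  assumes "pw_poly f" "0 \<le> r"
  shows "\<exists>g :: ('a + 'p \<Rightarrow> real) \<Rightarrow> real. pw_poly g \<and> (\<forall>p. g (case_sum (\<lambda>_. 0) p) =
    (\<integral>y. f (case_sum (\<lambda>b. if b \<in> Basis then y \<bullet> b else 0) p) * indicator (cbox (- r *\<^sub>R One) (r *\<^sub>R One)) y \<partial>lborel))"
proof -
  obtain g where g: "pw_poly g" "\<And>v. g v =
    (\<integral>x. f (merge_vars Basis x v) * (\<Prod>i\<in>Basis. indicator {- r..r} (x i)) \<partial>Pi\<^sub>M Basis (\<lambda>_. lborel))"
    using pw_poly_integral_box[OF finite_Basis assms] by blast
  have "g (case_sum (\<lambda>_. 0) p) =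
      (\<integral>y. f (case_sum (\<lambda>b. if b \<in> Basis then y \<bullet> b else 0) p) * indicator (cbox (- r *\<^sub>R One) (r *\<^sub>R One)) y \<partial>lborel)"
    (is "_ = (\<integral>y. ?F y \<partial>_)") for p
  proof -
    let ?M = "Pi\<^sub>M (Basis :: 'a set) (\<lambda>_. lborel :: real measure)"
    let ?\<phi> = "\<lambda>x. \<Sum>b\<in>(Basis :: 'a set). x b *\<^sub>R b"
    have \<phi>: "?\<phi> \<in> measurable ?M borel" by measurable
    have lb: "(lborel :: 'a measure) = distr ?M borel ?\<phi>"
      by (rule lborel_eq)
    have coord: "?\<phi> x \<bullet> b = x b" if "b \<in> Basis" for x b
      using that by (simp add: inner_sum_left inner_Basis if_distrib cong: if_cong)
    have F: "?F (?\<phi> x) = f (merge_vars Basis x (case_sum (\<lambda>_. 0) p)) * (\<Prod>i\<in>Basis. indicator {- r..r} (x i))" for x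
    proof -
      have "case_sum (\<lambda>b. if b \<in> Basis then ?\<phi> x \<bullet> b else 0) p = merge_vars Basis x (case_sum (\<lambda>_. 0) p)"
        by (auto simp: merge_vars_def fun_eq_iff coord split: sum.split)
      moreover have "indicator (cbox (- r *\<^sub>R One) (r *\<^sub>R One)) (?\<phi> x) = (\<Prod>i\<in>Basis. indicator {- r..r} (x i) :: real)"
      proof (cases "\<forall>b\<in>Basis. x b \<in> {- r..r}")
        case True
        then show ?thesis by (simp add: mem_box coord)
      next
        case False
        then have "\<exists>b\<in>Basis. indicator {- r..r} (x b) = (0 :: real)" by (auto simp: indicator_def)
        then have "(\<Prod>i\<in>Basis. indicator {- r..r} (x i) :: real) = 0" by (simp add: prod_zero_iff)
        then show ?thesis using False by (simp add: mem_box coord)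
      qed
      ultimately show ?thesis by simp
    qed
    have meas: "?F \<in> borel_measurable borel"
    proof -
      have "case_sum (\<lambda>b. if b \<in> Basis then y \<bullet> b else 0) p = merge_vars Basis (\<lambda>b\<in>Basis. y \<bullet> b) (case_sum (\<lambda>_. 0) p)" for y :: 'a
        by (auto simp: merge_vars_def fun_eq_iff split: sum.split)
      moreover have "(\<lambda>y::'a. \<lambda>b\<in>Basis. y \<bullet> b) \<in> measurable borel ?M" by measurable
      then have "(\<lambda>y. f (merge_vars Basis (\<lambda>b\<in>Basis. y \<bullet> b) (case_sum (\<lambda>_. 0) p))) \<in> borel_measurable borel"
        by (rule measurable_compose) (rule pw_poly_measurable[OF assms(1) finite_Basis])
      ultimately have "(\<lambda>y. f (case_sum (\<lambda>b. if b \<in> Basis then y \<bullet> b else 0) p)) \<in> borel_measurable borel"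
        by (simp only:)
      then show ?thesis by (intro borel_measurable_times borel_measurable_indicator) auto
    qed
    show ?thesis unfolding g(2) lb integral_distr[OF \<phi> meas] F ..
  qed
  with g(1) show ?thesis by blast
qed

subsection \<open>Lattices and their fundamental domains\<close>

text \<open>\<open>F\<close> is the half-open parallelepiped spanned by the basis; the floors of the
  coordinates of \<open>x\<close> give the unique lattice vector.\<close>

lemma lattice_fundamental_domain:
  fixes \<Gamma> :: "'c::euclidean_space set"
  assumes "is_lattice \<Gamma>"
  shows "\<exists>F. F \<in> sets borel \<and> bounded F \<and> (\<forall>x. \<exists>!\<gamma>\<in>\<Gamma>. x - \<gamma> \<in> F)"
proof -
  obtain B where B: "independent B" "span B = UNIV"
    and \<Gamma>: "\<Gamma> = {\<Sum>b\<in>B. of_int (c b) *\<^sub>R b | c. True}"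
    using assms unfolding is_lattice_def by blast
  have finB: "finite B" using B(1) by (rule independent_imp_finite)
  define \<rho> where "\<rho> x b = representation B x b" for x b
  have lin: "linear (\<lambda>x. \<rho> x b)" for b
    using B by (intro linearI) (simp_all add: \<rho>_def representation_add representation_scale)
  have sum: "(\<Sum>b\<in>B. \<rho> x b *\<^sub>R b) = x" for x
    using sum_representation_eq[OF B(1), of x B] B finB by (simp add: \<rho>_def)
  have \<rho>_sum: "\<rho> (\<Sum>b\<in>B. f b *\<^sub>R b) a = f a" if "a \<in> B" for f a
  proof -
    have "\<rho> b a = (if b = a then 1 else 0)" if "b \<in> B" for b
      using representation_basis[OF B(1) that] by (auto simp: \<rho>_def)
    then have "(\<Sum>b\<in>B. f b * \<rho> b a) = (\<Sum>b\<in>B. if b = a then f b else 0)"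
      by (intro sum.cong) auto
    then show ?thesis
      using that finB by (simp add: linear_sum[OF lin] linear_scale[OF lin])
  qed
  define F where "F = {x. \<forall>b\<in>B. \<rho> x b \<in> {0..<1}}"
  have "F = (\<Inter>b\<in>B. (\<lambda>x. \<rho> x b) -` {0..<1}) \<inter> UNIV" by (auto simp: F_def)
  moreover have "(\<lambda>x. \<rho> x b) -` {0..<1} \<in> sets borel" for b
  proof -
    have "bounded_linear (\<lambda>x. \<rho> x b)" using lin by (simp add: linear_conv_bounded_linear)
    then have "(\<lambda>x. \<rho> x b) \<in> borel_measurable borel"
      by (intro borel_measurable_continuous_onI linear_continuous_on)
    then show ?thesis by (rule measurable_sets_borel) auto
  qed
  ultimately have meas: "F \<in> sets borel"
    using finB by (cases "B = {}") (auto intro!: sets.finite_INT)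
  have "bounded F"
    unfolding bounded_iff
  proof (intro exI[of _ "\<Sum>b\<in>B. norm b"] ballI)
    fix x assume x: "x \<in> F"
    have "norm x \<le> (\<Sum>b\<in>B. norm (\<rho> x b *\<^sub>R b))" using norm_sum[of "\<lambda>b. \<rho> x b *\<^sub>R b" B] sum by simp
    also have "\<dots> \<le> (\<Sum>b\<in>B. norm b)"
      using x by (intro sum_mono) (auto simp: F_def intro!: mult_left_le_one_le)
    finally show "norm x \<le> (\<Sum>b\<in>B. norm b)" .
  qed
  moreover have "\<exists>!\<gamma>\<in>\<Gamma>. x - \<gamma> \<in> F" for x
  proof
    let ?g = "\<Sum>b\<in>B. of_int \<lfloor>\<rho> x b\<rfloor> *\<^sub>R b"
    have "\<rho> (x - ?g) b = \<rho> x b - of_int \<lfloor>\<rho> x b\<rfloor>" if "b \<in> B" for b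
      using that by (simp add: linear_diff[OF lin] \<rho>_sum)
    then show "?g \<in> \<Gamma> \<and> x - ?g \<in> F"
      by (auto simp: F_def \<Gamma> ) (linarith+)?
  next
    fix \<gamma> assume \<gamma>: "\<gamma> \<in> \<Gamma> \<and> x - \<gamma> \<in> F"
    then obtain c where c: "\<gamma> = (\<Sum>b\<in>B. of_int (c b) *\<^sub>R b)" by (auto simp: \<Gamma>)
    have "\<rho> (x - \<gamma>) b = \<rho> x b - of_int (c b)" if "b \<in> B" for b
      using that by (simp add: c linear_diff[OF lin] \<rho>_sum)
    then have "\<lfloor>\<rho> x b\<rfloor> = c b" if "b \<in> B" for b
      using \<gamma> that by (auto simp: F_def intro!: floor_unique)
    then show "\<gamma> = (\<Sum>b\<in>B. of_int \<lfloor>\<rho> x b\<rfloor> *\<^sub>R b)" unfolding c by (intro sum.cong) auto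
  qed
  ultimately show ?thesis using meas by (intro exI[of _ F]) simp
qed

lemma lattice_closed:
  assumes "is_lattice \<Gamma>" "x \<in> \<Gamma>" "y \<in> \<Gamma>"
  shows "x + y \<in> \<Gamma>" "x - y \<in> \<Gamma>" "0 \<in> \<Gamma>"
proof -
  obtain B where \<Gamma>: "\<Gamma> = {\<Sum>b\<in>B. of_int (c b) *\<^sub>R b | c. True}"
    using assms(1) unfolding is_lattice_def by blast
  then obtain c d where cd: "x = (\<Sum>b\<in>B. of_int (c b) *\<^sub>R b)" "y = (\<Sum>b\<in>B. of_int (d b) *\<^sub>R b)"
    using assms by blast
  show "x + y \<in> \<Gamma>" unfolding \<Gamma> cd
    by (intro CollectI exI[of _ "\<lambda>b. c b + d b"]) (simp add: scaleR_add_left sum.distrib)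
  show "x - y \<in> \<Gamma>" unfolding \<Gamma> cd
    by (intro CollectI exI[of _ "\<lambda>b. c b - d b"]) (simp add: scaleR_diff_left sum_subtractf)
  show "0 \<in> \<Gamma>" unfolding \<Gamma> by (intro CollectI exI[of _ "\<lambda>_. 0"]) simp
qed

lemma lattice_countable:
  assumes "is_lattice \<Gamma>"
  shows "countable \<Gamma>"
proof -
  obtain B where B: "independent B" and \<Gamma>: "\<Gamma> = {\<Sum>b\<in>B. of_int (c b) *\<^sub>R b | c. True}"
    using assms unfolding is_lattice_def by blast
  have sub: "\<Gamma> \<subseteq> (\<lambda>c. \<Sum>b\<in>B. of_int (c b) *\<^sub>R b) ` (Pi\<^sub>E B (\<lambda>_. UNIV :: int set))"
  proof
    fix x assume "x \<in> \<Gamma>"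
    then obtain c where "x = (\<Sum>b\<in>B. of_int (c b) *\<^sub>R b)" by (auto simp: \<Gamma>)
    then have "x = (\<Sum>b\<in>B. of_int (restrict c B b) *\<^sub>R b)" by simp
    then show "x \<in> (\<lambda>c. \<Sum>b\<in>B. of_int (c b) *\<^sub>R b) ` (Pi\<^sub>E B (\<lambda>_. UNIV))"
      by (rule image_eqI[where x = "restrict c B"]) simp
  qed
  have "countable (Pi\<^sub>E B (\<lambda>_. UNIV :: int set))"
    using independent_imp_finite[OF B] by (intro countable_PiE) auto
  then show ?thesis by (rule countable_subset[OF sub countable_image])
qed

text \<open>Averaging the lattice point count of \<open>E - z\<close> over \<open>z \<in> F\<close> gives the volume of \<open>E\<close> exactly.\<close>
lemma lattice_unfolding:
  fixes \<Gamma> :: "'c::euclidean_space set"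
  assumes \<Gamma>: "countable \<Gamma>" and F: "F \<in> sets borel" "\<And>x. \<exists>!\<gamma>\<in>\<Gamma>. x - \<gamma> \<in> F"
    and E: "E \<in> sets borel"
  shows "(\<integral>\<^sup>+z. indicator F z * emeasure (count_space UNIV) {\<gamma>\<in>\<Gamma>. z + \<gamma> \<in> E} \<partial>lborel) = emeasure lborel E"
proof -
  note [measurable] = F(1) E
  have "(\<integral>\<^sup>+z. indicator F z * emeasure (count_space UNIV) {\<gamma>\<in>\<Gamma>. z + \<gamma> \<in> E} \<partial>lborel) =
      (\<integral>\<^sup>+z. (\<integral>\<^sup>+\<gamma>. indicator F z * indicator E (z + \<gamma>) \<partial>count_space \<Gamma>) \<partial>lborel)"
  proof (rule nn_integral_cong)
    fix z
    have "(\<integral>\<^sup>+\<gamma>. indicator F z * indicator E (z + \<gamma>) \<partial>count_space \<Gamma>) =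
        indicator F z * (\<integral>\<^sup>+\<gamma>. indicator {\<gamma>\<in>\<Gamma>. z + \<gamma> \<in> E} \<gamma> \<partial>count_space UNIV)"
      by (subst nn_integral_count_space_indicator, simp,
          subst nn_integral_cmult[symmetric], simp)
        (auto intro!: nn_integral_cong simp: indicator_def)
    then show "indicator F z * emeasure (count_space UNIV) {\<gamma>\<in>\<Gamma>. z + \<gamma> \<in> E} =
        (\<integral>\<^sup>+\<gamma>. indicator F z * indicator E (z + \<gamma>) \<partial>count_space \<Gamma>)"
      by (simp add: nn_integral_indicator)
  qed
  also have "\<dots> = (\<integral>\<^sup>+\<gamma>. (\<integral>\<^sup>+z. indicator F z * indicator E (z + \<gamma>) \<partial>lborel) \<partial>count_space \<Gamma>)"
    by (intro nn_integral_count_space_nn_integral \<Gamma>) measurable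
  also have "\<dots> = (\<integral>\<^sup>+\<gamma>. emeasure lborel ((\<lambda>x. x - \<gamma>) -` F \<inter> E) \<partial>count_space \<Gamma>)"
  proof (rule nn_integral_cong)
    fix \<gamma>
    have "(\<integral>\<^sup>+z. indicator F z * indicator E (z + \<gamma>) \<partial>lborel) =
        (\<integral>\<^sup>+x. indicator F (x - \<gamma>) * indicator E x \<partial>distr lborel borel ((+) \<gamma>))"
      by (subst nn_integral_distr) (auto simp: add.commute)
    also have "\<dots> = (\<integral>\<^sup>+x. indicator ((\<lambda>x. x - \<gamma>) -` F \<inter> E) x \<partial>lborel)"
      unfolding lborel_distr_plus by (auto intro!: nn_integral_cong simp: indicator_def)
    also have "\<dots> = emeasure lborel ((\<lambda>x. x - \<gamma>) -` F \<inter> E)"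
      by (intro nn_integral_indicator) (simp add: measurable_sets_borel[of "\<lambda>x. x - \<gamma>" borel])
    finally show "(\<integral>\<^sup>+z. indicator F z * indicator E (z + \<gamma>) \<partial>lborel) = emeasure lborel ((\<lambda>x. x - \<gamma>) -` F \<inter> E)" .
  qed
  also have "\<dots> = emeasure lborel (\<Union>\<gamma>\<in>\<Gamma>. (\<lambda>x. x - \<gamma>) -` F \<inter> E)"
  proof (rule emeasure_UN_countable[symmetric])
    show "(\<lambda>x. x - \<gamma>) -` F \<inter> E \<in> sets lborel" for \<gamma>
      by (simp add: measurable_sets_borel[of "\<lambda>x. x - \<gamma>" borel])
    show "disjoint_family_on (\<lambda>\<gamma>. (\<lambda>x. x - \<gamma>) -` F \<inter> E) \<Gamma>"
      unfolding disjoint_family_on_def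
    proof (intro ballI impI)
      fix \<gamma> \<delta> assume *: "\<gamma> \<in> \<Gamma>" "\<delta> \<in> \<Gamma>" "\<gamma> \<noteq> \<delta>"
      have "\<not> (x - \<gamma> \<in> F \<and> x - \<delta> \<in> F)" for x using F(2)[of x] * by blast
      then show "(\<lambda>x. x - \<gamma>) -` F \<inter> E \<inter> ((\<lambda>x. x - \<delta>) -` F \<inter> E) = {}" by auto
    qed
  qed (rule \<Gamma>)
  also have "(\<Union>\<gamma>\<in>\<Gamma>. (\<lambda>x. x - \<gamma>) -` F \<inter> E) = E"
  proof -
    have "\<exists>\<gamma>\<in>\<Gamma>. x - \<gamma> \<in> F" for x using F(2)[of x] by blast
    then show ?thesis by auto
  qed
  finally show ?thesis .
qed

section \<open>Lattice point counts compared with volumes\<close>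

locale tiling =
  fixes \<Gamma> F :: "'c::euclidean_space set"
  assumes lattice: "is_lattice \<Gamma>"
    and F_borel: "F \<in> sets borel" and F_bounded: "bounded F"
    and F_tiles: "\<And>x. \<exists>!\<gamma>\<in>\<Gamma>. x - \<gamma> \<in> F"
begin

lemma unfolding_count:
  assumes "E \<in> sets borel"
  shows "(\<integral>\<^sup>+z. indicator F z * emeasure (count_space UNIV) {\<gamma>\<in>\<Gamma>. z + \<gamma> \<in> E} \<partial>lborel) = emeasure lborel E"
  using lattice_unfolding[OF lattice_countable[OF lattice] F_borel F_tiles assms] .

lemma emeasure_F_finite: "emeasure lborel F < \<infinity>"
  using emeasure_bounded_finite[OF F_bounded] .

text \<open>If \<open>F\<close> were null, the unfolding integral for \<open>E = UNIV\<close> would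
  vanish, whereas the whole space has positive volume.\<close>

lemma measure_F_pos: "0 < measure lborel F"
proof (rule ccontr)
  assume "\<not> 0 < measure lborel F"
  then have "measure lborel F = 0" using measure_nonneg[of lborel F] by linarith
  then have 0: "emeasure lborel F = 0"
    using emeasure_F_finite by (auto simp: measure_def enn2real_eq_0_iff)
  then have "AE z in lborel. z \<notin> F"
    using F_borel by (intro AE_not_in) (simp add: null_sets_def)
  then have "(\<integral>\<^sup>+z. indicator F z * emeasure (count_space UNIV) {\<gamma>\<in>\<Gamma>. z + \<gamma> \<in> UNIV} \<partial>lborel) = (\<integral>\<^sup>+z. 0 \<partial>(lborel :: 'c measure))"
    by (intro nn_integral_cong_AE) (auto elim!: eventually_mono)
  then show False using unfolding_count[of UNIV] by simp
qed

text \<open>A pointwise bound under the unfolding integral. The injection may vary with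
  \<open>z\<close> while \<open>T\<close> stays fixed, so each shift can be compensated by its own
  lattice translation.\<close>

lemma emeasure_le_count:
  assumes "E \<in> sets borel" "finite T"
    and "\<And>z. z \<in> F \<Longrightarrow> \<exists>f. inj_on f {\<gamma>\<in>\<Gamma>. z + \<gamma> \<in> E} \<and> f ` {\<gamma>\<in>\<Gamma>. z + \<gamma> \<in> E} \<subseteq> T"
  shows "emeasure lborel E \<le> of_nat (card T) * emeasure lborel F"
proof -
  have "emeasure lborel E = (\<integral>\<^sup>+z. indicator F z * emeasure (count_space UNIV) {\<gamma>\<in>\<Gamma>. z + \<gamma> \<in> E} \<partial>lborel)"
    using unfolding_count[OF assms(1)] by simp
  also have "\<dots> \<le> (\<integral>\<^sup>+z. of_nat (card T) * indicator F z \<partial>lborel)"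
  proof (rule nn_integral_mono)
    fix z
    show "indicator F z * emeasure (count_space UNIV) {\<gamma>\<in>\<Gamma>. z + \<gamma> \<in> E} \<le> of_nat (card T) * indicator F z"
    proof (cases "z \<in> F")
      case True
      then obtain f where "inj_on f {\<gamma>\<in>\<Gamma>. z + \<gamma> \<in> E}" "f ` {\<gamma>\<in>\<Gamma>. z + \<gamma> \<in> E} \<subseteq> T"
        using assms(3) by blast
      then have "finite {\<gamma>\<in>\<Gamma>. z + \<gamma> \<in> E}" "card {\<gamma>\<in>\<Gamma>. z + \<gamma> \<in> E} \<le> card T"
        using assms(2) by (auto intro: card_inj_on_le inj_on_finite)
      then show ?thesis by (simp add: emeasure_count_space_finite True)
    qed simp
  qed
  also have "\<dots> = of_nat (card T) * emeasure lborel F"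
    using F_borel by (simp add: nn_integral_cmult_indicator)
  finally show ?thesis .
qed

lemma count_le_emeasure:
  assumes "E \<in> sets borel" "finite T"
    and "\<And>z. z \<in> F \<Longrightarrow> \<exists>f. inj_on f T \<and> f ` T \<subseteq> {\<gamma>\<in>\<Gamma>. z + \<gamma> \<in> E}"
  shows "of_nat (card T) * emeasure lborel F \<le> emeasure lborel E"
proof -
  have "of_nat (card T) * emeasure lborel F = (\<integral>\<^sup>+z. of_nat (card T) * indicator F z \<partial>lborel)"
    using F_borel by (simp add: nn_integral_cmult_indicator)
  also have "\<dots> \<le> (\<integral>\<^sup>+z. indicator F z * emeasure (count_space UNIV) {\<gamma>\<in>\<Gamma>. z + \<gamma> \<in> E} \<partial>lborel)"
  proof (rule nn_integral_mono)
    fix z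
    show "of_nat (card T) * indicator F z \<le> indicator F z * emeasure (count_space UNIV) {\<gamma>\<in>\<Gamma>. z + \<gamma> \<in> E}"
    proof (cases "z \<in> F")
      case True
      then obtain f where f: "inj_on f T" "f ` T \<subseteq> {\<gamma>\<in>\<Gamma>. z + \<gamma> \<in> E}"
        using assms(3) by blast
      have "of_nat (card T) = emeasure (count_space UNIV) (f ` T)"
        using assms(2) f(1) by (simp add: emeasure_count_space_finite card_image)
      also have "\<dots> \<le> emeasure (count_space UNIV) {\<gamma>\<in>\<Gamma>. z + \<gamma> \<in> E}"
        using f(2) by (intro emeasure_mono) auto
      finally show ?thesis by (simp add: True)
    qed simp
  qed
  also have "\<dots> = emeasure lborel E" using unfolding_count[OF assms(1)] .
  finally show ?thesis .
qed

text \<open>Cardinalities of finite subsets are bounded: translates of \<open>T\<close> by points of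
  \<open>F\<close> stay in one ball of radius \<open>b + a\<close>, whose volume is thus at least
  \<open>card T\<close> times that of \<open>F\<close>.\<close>

lemma finite_bounded_Int:
  assumes "bounded S"
  shows "finite (\<Gamma> \<inter> S)"
proof -
  obtain a b where a: "\<And>x. x \<in> S \<Longrightarrow> norm x \<le> a" and b: "\<And>x. x \<in> F \<Longrightarrow> norm x \<le> b"
    using assms F_bounded unfolding bounded_iff by blast
  let ?E = "cball 0 (b + a) :: 'c set"
  define v where "v = measure lborel F"
  have v: "v > 0" "emeasure lborel F = ennreal v"
    using measure_F_pos emeasure_F_finite by (auto simp: v_def emeasure_eq_ennreal_measure)
  have E: "emeasure lborel ?E = ennreal (measure lborel ?E)"
    using emeasure_lborel_cball_finite[of "0 :: 'c" "b + a"]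
    by (intro emeasure_eq_ennreal_measure) auto
  obtain N where N: "measure lborel ?E < real N * v" using reals_Archimedean3[OF v(1)] by blast
  have "card T < N" if T: "finite T" "T \<subseteq> \<Gamma> \<inter> S" for T
  proof -
    have "of_nat (card T) * emeasure lborel F \<le> emeasure lborel ?E"
    proof (rule count_le_emeasure)
      fix z assume "z \<in> F"
      then have "id ` T \<subseteq> {\<gamma>\<in>\<Gamma>. z + \<gamma> \<in> ?E}"
        using T(2) a b by (auto intro!: order_trans[OF norm_triangle_ineq] add_mono)
      then show "\<exists>f. inj_on f T \<and> f ` T \<subseteq> {\<gamma>\<in>\<Gamma>. z + \<gamma> \<in> ?E}" using inj_on_id by blast
    qed (use T in auto)
    then have "ennreal (real (card T) * v) \<le> ennreal (measure lborel ?E)"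
      unfolding v E by (simp add: ennreal_mult ennreal_of_nat_eq_real_of_nat v(1) less_imp_le)
    then have "real (card T) * v \<le> measure lborel ?E" by (simp add: ennreal_le_iff)
    with N have "real (card T) * v < real N * v" by linarith
    then show "card T < N" using v(1) by simp
  qed
  then show ?thesis
    by (metis infinite_arbitrarily_large less_irrefl)
qed

end

subsection \<open>Equidistribution of lattice strips\<close>

text \<open>A null boundary gives \<open>interior A\<close> and \<open>closure A\<close> the measure
  of \<open>A\<close>. Regularity of the measure supplies \<open>C\<close> and \<open>U\<close>, and
  compactness of \<open>C\<close> and \<open>closure A\<close> turns the inclusions into a uniform
  margin \<open>\<epsilon>\<close>.\<close>

lemma jordan_approximation:
  fixes A :: "'a::euclidean_space set"
  assumes "bounded A" "negligible (frontier A)" "0 < \<eta>"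
  obtains C U \<epsilon> where "compact C" "open U" "bounded U" "0 < \<epsilon>"
    "\<And>x y. x \<in> C \<Longrightarrow> dist x y < \<epsilon> \<Longrightarrow> y \<in> A" "\<And>x y. x \<in> A \<Longrightarrow> dist x y < \<epsilon> \<Longrightarrow> y \<in> U"
    "measure lebesgue A - \<eta> < measure lebesgue C" "measure lebesgue U < measure lebesgue A + \<eta>"
proof -
  have int: "interior A \<in> lmeasurable" "measure lebesgue (interior A) = measure lebesgue A"
    using lmeasurable_interior[OF assms(1)] measure_interior[OF assms(1,2)] by blast+
  have cl: "closure A \<in> lmeasurable" "measure lebesgue (closure A) = measure lebesgue A"
    using lmeasurable_closure[OF assms(1)] measure_closure[OF assms(1,2)] by blast+
  obtain C where C: "closed C" "C \<subseteq> interior A" "interior A - C \<in> lmeasurable"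
    "emeasure lebesgue (interior A - C) < ennreal \<eta>"
    using sets_lebesgue_inner_closed[OF fmeasurableD[OF int(1)] assms(3)] by blast
  have "bounded C" using C(2) assms(1) bounded_subset interior_subset by blast
  then have compC: "compact C" using C(1) by (simp add: compact_eq_bounded_closed)
  have "measure lebesgue (interior A - C) < \<eta>"
    using C(3,4) assms(3) by (simp add: emeasure_eq_measure2 ennreal_less_iff)
  moreover have "measure lebesgue (interior A - C) = measure lebesgue (interior A) - measure lebesgue C"
    using C(2) int(1) compC by (intro measurable_measure_Diff) (auto simp: fmeasurableD lmeasurable_compact)
  ultimately have mC: "measure lebesgue A - \<eta> < measure lebesgue C" using int(2) by linarith
  obtain V where V: "open V" "closure A \<subseteq> V" "V - closure A \<in> lmeasurable"
    "emeasure lebesgue (V - closure A) < ennreal \<eta>"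
    using sets_lebesgue_outer_open[OF fmeasurableD[OF cl(1)] assms(3)] by blast
  obtain a where a: "closure A \<subseteq> ball 0 a"
    using assms(1) bounded_closure bounded_subset_ballD by blast
  define U where "U = V \<inter> ball 0 a"
  have U: "open U" "bounded U" "closure A \<subseteq> U" using V a by (auto simp: U_def)
  have Um: "U \<in> lmeasurable" using U by (simp add: lmeasurable_open)
  have "measure lebesgue (U - closure A) \<le> measure lebesgue (V - closure A)"
    using Um cl(1) by (intro measure_mono_fmeasurable[OF _ _ V(3)]) (auto simp: U_def fmeasurableD)
  also have "\<dots> < \<eta>" using V(3,4) assms(3) by (simp add: emeasure_eq_measure2 ennreal_less_iff)
  finally have "measure lebesgue (U - closure A) < \<eta>" .
  moreover have "measure lebesgue (U - closure A) = measure lebesgue U - measure lebesgue (closure A)"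
    using U(3) cl(1) Um by (intro measurable_measure_Diff) (auto simp: fmeasurableD)
  ultimately have mU: "measure lebesgue U < measure lebesgue A + \<eta>" using cl(2) by linarith
  obtain e1 where e1: "e1 > 0" "(\<Union>x\<in>C. ball x e1) \<subseteq> interior A"
    using compact_subset_open_imp_ball_epsilon_subset[OF compC open_interior C(2)] by blast
  obtain e2 where e2: "e2 > 0" "(\<Union>x\<in>closure A. ball x e2) \<subseteq> U"
    using compact_subset_open_imp_ball_epsilon_subset[OF _ U(1,3)] assms(1) compact_closure by blast
  show ?thesis
  proof (rule that[of C U "min e1 e2"])
    show "y \<in> A" if "x \<in> C" "dist x y < min e1 e2" for x y
      using e1(2) that interior_subset[of A] by fastforce
    show "y \<in> U" if "x \<in> A" "dist x y < min e1 e2" for x y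
      using e2(2) that closure_subset[of A] by fastforce
  qed (use compC U e1 e2 mC mU in auto)
qed

text \<open>Absorbs the bounded change of radius that translation by a lattice vector
  causes.\<close>

lemma ball_volume_shift_tendsto:
  fixes d :: real
  shows "((\<lambda>R. measure lborel (ball (0::'a::euclidean_space) (R + d)) / measure lborel (ball (0::'a) R)) \<longlongrightarrow> 1) at_top"
proof -
  have "((\<lambda>R. ((R + d) / R) ^ DIM('a)) \<longlongrightarrow> 1 ^ DIM('a)) at_top"
    by (intro tendsto_power) real_asymp
  moreover have "\<forall>\<^sub>F R in at_top. ((R + d) / R) ^ DIM('a) =
      measure lborel (ball (0::'a) (R + d)) / measure lborel (ball (0::'a) R)"
    using eventually_gt_at_top[of "max 0 (- d)"]
  proof eventually_elim
    case (elim R)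
    have "measure lborel (ball (0::'a) 1) > 0" by (simp add: content_ball_pos)
    then show ?case
      using elim content_ball_conv_unit_ball[of R "0::'a"] content_ball_conv_unit_ball[of "R + d" "0::'a"]
      by (simp add: power_divide)
  qed
  ultimately show ?thesis by (simp add: tendsto_cong)
qed

lemma finite_dense_net:
  fixes V D :: "'a::metric_space set"
  assumes "compact V" "closure D = UNIV" "0 < \<epsilon>"
  shows "\<exists>T. finite T \<and> T \<subseteq> D \<and> (\<forall>v\<in>V. \<exists>t\<in>T. dist t v < \<epsilon>)"
proof -
  have "V \<subseteq> (\<Union>t\<in>D. ball t \<epsilon>)"
  proof
    fix v
    obtain t where "t \<in> D" "dist t v < \<epsilon>" using assms(2,3) closure_approachable[of v D] by auto
    then show "v \<in> (\<Union>t\<in>D. ball t \<epsilon>)" by auto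
  qed
  then obtain T where "T \<subseteq> D" "finite T" "V \<subseteq> (\<Union>t\<in>T. ball t \<epsilon>)"
    using compactE_image[OF assms(1), of D "\<lambda>t. ball t \<epsilon>"] by auto
  moreover have "\<exists>t\<in>T. dist t v < \<epsilon>" if "v \<in> V" for v
  proof -
    from \<open>V \<subseteq> (\<Union>t\<in>T. ball t \<epsilon>)\<close> that obtain t where "t \<in> T" "v \<in> ball t \<epsilon>" by blast
    then show ?thesis unfolding mem_ball by blast
  qed
  ultimately show ?thesis by blast
qed

locale model_set = tiling \<Gamma> F for \<Gamma> F :: "('a::euclidean_space \<times> 'b::euclidean_space) set" +
  assumes dense: "closure (snd ` \<Gamma>) = UNIV"
begin

definition strip :: "'b set \<Rightarrow> real \<Rightarrow> ('a \<times> 'b) set" where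
  "strip A R = {\<gamma>\<in>\<Gamma>. fst \<gamma> \<in> ball 0 R \<and> snd \<gamma> \<in> A}"

lemma finite_strip: "bounded A \<Longrightarrow> finite (strip A R)"
  using finite_bounded_Int[of "ball 0 R \<times> A"]
  by (simp add: bounded_Times strip_def mem_Times_iff Int_def)

text \<open>By density, every shift \<open>z \<in> F\<close> agrees up to \<open>\<epsilon>\<close> in the internal coordinate with one of
  finitely many lattice vectors; translating by it changes counts only near the boundary of the ball.\<close>
lemma strip_sandwich:
  assumes "0 < \<epsilon>"
  obtains d where "\<And>A C R. bounded A \<Longrightarrow> C \<in> sets borel \<Longrightarrow> bounded C \<Longrightarrow>
      (\<And>x y. x \<in> C \<Longrightarrow> dist x y < \<epsilon> \<Longrightarrow> y \<in> A) \<Longrightarrow>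
      measure lborel (ball (0::'a) R) * measure lborel C \<le> card (strip A (R + d)) * measure lborel F"
    "\<And>A U R. bounded A \<Longrightarrow> U \<in> sets borel \<Longrightarrow> bounded U \<Longrightarrow>
      (\<And>x y. x \<in> A \<Longrightarrow> dist x y < \<epsilon> \<Longrightarrow> y \<in> U) \<Longrightarrow>
      card (strip A R) * measure lborel F \<le> measure lborel (ball (0::'a) (R + d)) * measure lborel U"
proof -
  have "compact (closure (snd ` F))"
    using F_bounded by (simp add: compact_closure bounded_snd)
  from finite_dense_net[OF this dense assms] obtain T0 where
    T0: "finite T0" "T0 \<subseteq> snd ` \<Gamma>" "\<forall>v\<in>closure (snd ` F). \<exists>t\<in>T0. dist t v < \<epsilon>"
    by (elim exE conjE)
  obtain T where T: "finite T" "T \<subseteq> \<Gamma>" "T0 = snd ` T"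
    using finite_subset_image[OF T0(1,2)] by metis
  obtain d1 where d1: "\<And>z. z \<in> F \<Longrightarrow> norm z \<le> d1" using F_bounded by (auto simp: bounded_iff)
  obtain d2 where d2: "\<And>z. z \<in> T \<Longrightarrow> norm z \<le> d2"
    using finite_imp_bounded[OF T(1)] by (auto simp: bounded_iff)
  \<comment> \<open>\<open>d1\<close> bounds the shifts and \<open>d2\<close> the finitely many
    compensating lattice vectors, so \<open>d\<close> depends on \<open>\<epsilon>\<close> but on
    neither the region nor \<open>R\<close>.\<close>
  define d where "d = d1 + d2"
  have shift: "\<exists>\<tau>\<in>\<Gamma>. dist (snd \<tau>) (snd z) < \<epsilon> \<and> norm (fst z) + norm (fst \<tau>) \<le> d" if "z \<in> F" for z
  proof -
    have "snd z \<in> closure (snd ` F)" using closure_subset[THEN subsetD, OF imageI[OF that]] .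
    then obtain \<tau> where \<tau>: "\<tau> \<in> T" "dist (snd \<tau>) (snd z) < \<epsilon>" using T0(3) T(3) by blast
    have "norm (fst z) \<le> d1" "norm (fst \<tau>) \<le> d2"
      using d1[OF that] d2[OF \<tau>(1)] norm_fst_le[of "fst z" "snd z"] norm_fst_le[of "fst \<tau>" "snd \<tau>"] by auto
    with \<tau> T(2) show ?thesis by (auto simp: d_def)
  qed
  have vol: "emeasure lborel (ball (0::'a) R \<times> C) = ennreal (measure lborel (ball (0::'a) R) * measure lborel C)"
    if "C \<in> sets borel" "bounded C" for R and C :: "'b set"
  proof -
    have "emeasure lborel (ball (0::'a) R \<times> C) = emeasure lborel (ball (0::'a) R) * emeasure lborel C"
      using that by (simp add: lborel_prod[symmetric] lborel.emeasure_pair_measure_Times)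
    also have "\<dots> = ennreal (measure lborel (ball (0::'a) R) * measure lborel C)"
      using emeasure_bounded_finite[OF that(2)] emeasure_bounded_finite[OF bounded_ball[of "0::'a" R]]
      by (simp add: emeasure_eq_ennreal_measure ennreal_mult)
    finally show ?thesis .
  qed
  have borel: "ball (0::'a) R \<times> C \<in> sets borel" if "C \<in> sets borel" for R and C :: "'b set"
    using that by (simp add: borel_prod[symmetric])
  have volF: "of_nat k * emeasure lborel F = ennreal (real k * measure lborel F)" for k
    using emeasure_F_finite by (simp add: emeasure_eq_ennreal_measure ennreal_mult ennreal_of_nat_eq_real_of_nat)
  show ?thesis
  proof (rule that[of d])
    fix A C :: "'b set" and R
    assume A: "bounded A" "C \<in> sets borel" "bounded C" "\<And>x y. x \<in> C \<Longrightarrow> dist x y < \<epsilon> \<Longrightarrow> y \<in> A"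
    have "emeasure lborel (ball (0::'a) R \<times> C) \<le> of_nat (card (strip A (R + d))) * emeasure lborel F"
    proof (rule emeasure_le_count)
      fix z assume "z \<in> F"
      then obtain \<tau> where \<tau>: "\<tau> \<in> \<Gamma>" "dist (snd \<tau>) (snd z) < \<epsilon>" "norm (fst z) + norm (fst \<tau>) \<le> d"
        using shift by blast
      have "\<gamma> + \<tau> \<in> strip A (R + d)" if "\<gamma> \<in> \<Gamma>" "z + \<gamma> \<in> ball 0 R \<times> C" for \<gamma>
      proof -
        \<comment> \<open>Exchanging \<open>z\<close> for \<open>\<tau>\<close> moves the internal
          coordinate by less than \<open>\<epsilon>\<close>, so a point over \<open>C\<close> lands
          over \<open>A\<close>.\<close>
        have "dist (snd (z + \<gamma>)) (snd (\<gamma> + \<tau>)) = dist (snd \<tau>) (snd z)"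
          by (simp add: dist_norm norm_minus_commute algebra_simps)
        then have "snd (\<gamma> + \<tau>) \<in> A" using A(4)[of "snd (z + \<gamma>)"] that(2) \<tau>(2) by (simp add: mem_Times_iff)
        moreover have "norm (fst (\<gamma> + \<tau>)) \<le> norm (fst (z + \<gamma>)) + norm (fst z) + norm (fst \<tau>)"
          using norm_triangle_ineq[of "fst \<gamma>" "fst \<tau>"] norm_triangle_ineq4[of "fst (z + \<gamma>)" "fst z"] by simp
        then have "norm (fst (\<gamma> + \<tau>)) < R + d" using that(2) \<tau>(3) by (simp add: mem_Times_iff)
        ultimately show ?thesis
          using lattice_closed[OF lattice that(1) \<tau>(1)] by (simp add: strip_def)
      qed
      then show "\<exists>f. inj_on f {\<gamma>\<in>\<Gamma>. z + \<gamma> \<in> ball 0 R \<times> C} \<and> f ` {\<gamma>\<in>\<Gamma>. z + \<gamma> \<in> ball 0 R \<times> C} \<subseteq> strip A (R + d)"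
        by (intro exI[of _ "\<lambda>\<gamma>. \<gamma> + \<tau>"]) (auto simp: inj_on_def)
    qed (use A borel finite_strip in auto)
    then show "measure lborel (ball (0::'a) R) * measure lborel C \<le> card (strip A (R + d)) * measure lborel F"
      by (simp add: vol[OF A(2,3)] volF)
  next
    fix A U :: "'b set" and R
    assume A: "bounded A" "U \<in> sets borel" "bounded U" "\<And>x y. x \<in> A \<Longrightarrow> dist x y < \<epsilon> \<Longrightarrow> y \<in> U"
    have "of_nat (card (strip A R)) * emeasure lborel F \<le> emeasure lborel (ball (0::'a) (R + d) \<times> U)"
    proof (rule count_le_emeasure)
      fix z assume "z \<in> F"
      then obtain \<tau> where \<tau>: "\<tau> \<in> \<Gamma>" "dist (snd \<tau>) (snd z) < \<epsilon>" "norm (fst z) + norm (fst \<tau>) \<le> d"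
        using shift by blast
      have "\<gamma> - \<tau> \<in> \<Gamma> \<and> z + (\<gamma> - \<tau>) \<in> ball 0 (R + d) \<times> U" if "\<gamma> \<in> strip A R" for \<gamma>
      proof -
        have "dist (snd \<gamma>) (snd (z + (\<gamma> - \<tau>))) = dist (snd \<tau>) (snd z)"
          by (simp add: dist_norm norm_minus_commute algebra_simps)
        then have "snd (z + (\<gamma> - \<tau>)) \<in> U" using A(4)[of "snd \<gamma>"] that \<tau>(2) by (simp add: strip_def)
        moreover have "norm (fst (z + (\<gamma> - \<tau>))) \<le> norm (fst z) + (norm (fst \<gamma>) + norm (fst \<tau>))"
          using norm_triangle_ineq[of "fst z" "fst \<gamma> - fst \<tau>"] norm_triangle_ineq4[of "fst \<gamma>" "fst \<tau>"] by simp
        then have "norm (fst (z + (\<gamma> - \<tau>))) < R + d" using that \<tau>(3) by (simp add: strip_def)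
        ultimately show ?thesis
          using that lattice_closed[OF lattice _ \<tau>(1)] by (simp add: strip_def mem_Times_iff)
      qed
      then show "\<exists>f. inj_on f (strip A R) \<and> f ` strip A R \<subseteq> {\<gamma>\<in>\<Gamma>. z + \<gamma> \<in> ball 0 (R + d) \<times> U}"
        by (intro exI[of _ "\<lambda>\<gamma>. \<gamma> - \<tau>"]) (auto simp: inj_on_def)
    qed (use A borel finite_strip in auto)
    then show "card (strip A R) * measure lborel F \<le> measure lborel (ball (0::'a) (R + d)) * measure lborel U"
      by (simp add: vol[OF A(2,3)] volF)
  qed
qed

text \<open>Inner and outer approximations of \<open>A\<close> put the normalised counts between
  bounds arbitrarily close to the volume of \<open>A\<close>; the shift \<open>d\<close> of the
  radius disappears in the limit.\<close>

lemma strip_density: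
  assumes A: "bounded A" "negligible (frontier A)"
  shows "((\<lambda>R. card (strip A R) / measure lborel (ball (0::'a) R)) \<longlongrightarrow> measure lebesgue A / measure lborel F) at_top"
proof -
  let ?B = "\<lambda>R. measure lborel (ball (0::'a) R)"
  let ?n = "\<lambda>R. card (strip A R) * measure lborel F / ?B R"
  have Bpos: "0 < ?B R" if "0 < R" for R using that by (simp add: content_ball_pos)
  have "(?n \<longlongrightarrow> measure lebesgue A) at_top"
  proof (rule order_tendstoI)
    fix a assume "a < measure lebesgue A"
    then have "0 < measure lebesgue A - a" by simp
    from jordan_approximation[OF A this] obtain C \<epsilon> where C: "compact C" "0 < \<epsilon>"
      "\<And>x y. x \<in> C \<Longrightarrow> dist x y < \<epsilon> \<Longrightarrow> y \<in> A" "a < measure lebesgue C" by (metis diff_diff_eq2 add_diff_cancel_left')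
    obtain d where d: "\<And>R. ?B R * measure lborel C \<le> card (strip A (R + d)) * measure lborel F"
      using strip_sandwich[OF C(2)] A(1) C(1,3) by (metis borel_compact compact_imp_bounded)
    have "measure lebesgue C = measure lborel C"
      using C(1) by (simp add: borel_compact measure_completion)
    then have "a < 1 * measure lborel C" using C(4) by simp
    moreover have "((\<lambda>R. ?B (R + - d) / ?B R * measure lborel C) \<longlongrightarrow> 1 * measure lborel C) at_top"
      by (intro tendsto_mult ball_volume_shift_tendsto tendsto_const)
    ultimately have "\<forall>\<^sub>F R in at_top. a < ?B (R + - d) / ?B R * measure lborel C"
      using order_tendstoD(1) by blast
    then show "\<forall>\<^sub>F R in at_top. a < ?n R"
      using eventually_gt_at_top[of 0]
    proof eventually_elim
      case (elim R)
      \<comment> \<open>The lower sandwich bound is used at radius \<open>R - d\<close>, so that the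
        count is that of the strip of radius \<open>R\<close>.\<close>
      have "?B (R + - d) * measure lborel C \<le> card (strip A R) * measure lborel F"
        using d[of "R + - d"] by simp
      then have "?B (R + - d) * measure lborel C / ?B R \<le> ?n R"
        using Bpos[OF elim(2)] by (intro divide_right_mono) auto
      with elim(1) show ?case by simp
    qed
  next
    fix a assume "measure lebesgue A < a"
    then have "0 < a - measure lebesgue A" by simp
    from jordan_approximation[OF A this] obtain U \<epsilon> where U: "open U" "bounded U" "0 < \<epsilon>"
      "\<And>x y. x \<in> A \<Longrightarrow> dist x y < \<epsilon> \<Longrightarrow> y \<in> U" "measure lebesgue U < a" by (metis add.commute diff_add_cancel)
    obtain d where d: "\<And>R. card (strip A R) * measure lborel F \<le> ?B (R + d) * measure lborel U"
      using strip_sandwich[OF U(3)] A(1) U(1,2,4) by (metis borel_open)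
    have "measure lebesgue U = measure lborel U"
      using U(1) by (simp add: measure_completion)
    then have "1 * measure lborel U < a" using U(5) by simp
    moreover have "((\<lambda>R. ?B (R + d) / ?B R * measure lborel U) \<longlongrightarrow> 1 * measure lborel U) at_top"
      by (intro tendsto_mult ball_volume_shift_tendsto tendsto_const)
    ultimately have "\<forall>\<^sub>F R in at_top. ?B (R + d) / ?B R * measure lborel U < a"
      using order_tendstoD(2) by blast
    then show "\<forall>\<^sub>F R in at_top. ?n R < a"
      using eventually_gt_at_top[of 0]
    proof eventually_elim
      case (elim R)
      have "?n R \<le> ?B (R + d) * measure lborel U / ?B R"
        using Bpos[OF elim(2)] d[of R] by (intro divide_right_mono) auto
      with elim(1) show ?case by simp
    qed
  qed
  then have "((\<lambda>R. ?n R / measure lborel F) \<longlongrightarrow> measure lebesgue A / measure lborel F) at_top"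
    using measure_F_pos by (intro tendsto_divide tendsto_const) auto
  then show ?thesis using measure_F_pos by simp
qed

end

subsection \<open>Acceptance domains\<close>

lemma polytope_inequalities:
  fixes P :: "'a::euclidean_space set"
  assumes "polytope P"
  shows "\<exists>T. finite T \<and> (\<forall>y. y \<in> P \<longleftrightarrow> (\<forall>h\<in>T. fst h \<bullet> y \<le> snd h))"
proof -
  obtain \<H> where \<H>: "finite \<H>" "P = \<Inter>\<H>" "\<forall>h\<in>\<H>. \<exists>a b. a \<noteq> 0 \<and> h = {x. a \<bullet> x \<le> b}"
    using polytope_imp_polyhedron[OF assms] unfolding polyhedron_def by metis
  have "\<forall>h\<in>\<H>. \<exists>p. \<forall>x. x \<in> h \<longleftrightarrow> fst p \<bullet> x \<le> snd p"
  proof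
    fix h assume "h \<in> \<H>"
    then obtain a b where "h = {x. a \<bullet> x \<le> b}" using \<H>(3) by blast
    then show "\<exists>p. \<forall>x. x \<in> h \<longleftrightarrow> fst p \<bullet> x \<le> snd p" by (intro exI[of _ "(a, b)"]) simp
  qed
  from bchoice[OF this] obtain p where p: "\<forall>h\<in>\<H>. \<forall>x. x \<in> h \<longleftrightarrow> fst (p h) \<bullet> x \<le> snd (p h)" ..
  have "y \<in> P \<longleftrightarrow> (\<forall>h\<in>p ` \<H>. fst h \<bullet> y \<le> snd h)" for y
    unfolding \<H>(2) using p by blast
  then show ?thesis using \<H>(1) by (intro exI[of _ "p ` \<H>"]) blast
qed

text \<open>Pooling the inequalities of all polytopes in one finite \<open>H\<close> makes
  membership in \<open>K\<close> a function of finitely many truth values, which transfers directly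
  to translates of \<open>K\<close>.\<close>

lemma compact_polyhedron_inequalities:
  fixes K :: "'a::euclidean_space set"
  assumes "compact_polyhedron K"
  shows "bounded K"
    "\<exists>H \<T>. finite H \<and> (\<forall>T\<in>\<T>. T \<subseteq> H) \<and> (\<forall>y. y \<in> K \<longleftrightarrow> (\<exists>T\<in>\<T>. \<forall>h\<in>T. fst h \<bullet> y \<le> snd h))"
proof -
  obtain \<F> where F: "finite \<F>" "\<forall>P\<in>\<F>. polytope P" "K = \<Union>\<F>"
    using assms unfolding compact_polyhedron_def by (elim exE conjE)
  show "bounded K" unfolding F(3) using F(1,2) polytope_imp_bounded by (intro bounded_Union) auto
  have "\<forall>P\<in>\<F>. \<exists>T. finite T \<and> (\<forall>y. y \<in> P \<longleftrightarrow> (\<forall>h\<in>T. fst h \<bullet> y \<le> snd h))"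
    using F(2) polytope_inequalities by blast
  from bchoice[OF this] obtain T where
    T: "\<forall>P\<in>\<F>. finite (T P) \<and> (\<forall>y. y \<in> P \<longleftrightarrow> (\<forall>h\<in>T P. fst h \<bullet> y \<le> snd h))" ..
  have "finite (\<Union>(T ` \<F>))" using F(1) T by blast
  moreover have "y \<in> K \<longleftrightarrow> (\<exists>T\<in>T ` \<F>. \<forall>h\<in>T. fst h \<bullet> y \<le> snd h)" for y
    unfolding F(3) Union_iff bex_simps using T by auto
  ultimately show "\<exists>H \<T>. finite H \<and> (\<forall>T\<in>\<T>. T \<subseteq> H) \<and> (\<forall>y. y \<in> K \<longleftrightarrow> (\<exists>T\<in>\<T>. \<forall>h\<in>T. fst h \<bullet> y \<le> snd h))"
    by (intro exI[of _ "\<Union>(T ` \<F>)"] exI[of _ "T ` \<F>"]) blast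
qed

text \<open>The offsets are variables and the normals are constants, so the volume is one fixed
  piecewise polynomial function of the offsets; hence \<open>G\<close> can precede \<open>l\<close>
  and \<open>u\<close>.\<close>

lemma slab_volume_finitely_generated:
  fixes nrm :: "'h \<Rightarrow> 'a::euclidean_space"
  assumes "finite H" "finite C" "0 \<le> r"
  shows "\<exists>G. finite G \<and>
    (\<forall>l u. (\<forall>h\<in>H. l h \<in> subgroup_generated C \<and> u h \<in> subgroup_generated C) \<longrightarrow>
      measure lborel ({y. \<forall>h\<in>H. l h < nrm h \<bullet> y \<and> nrm h \<bullet> y \<le> u h} \<inter> cbox (- r *\<^sub>R One) (r *\<^sub>R One))
        \<in> subgroup_generated G)"
proof -
  \<comment> \<open>\<open>Inl b\<close> stands for the coordinate of \<open>y\<close> along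
    \<open>b\<close>; \<open>Inr (h, False)\<close> and \<open>Inr (h, True)\<close> stand for the
    lower and upper offset at \<open>h\<close>.\<close>
  define L where "L h v = (\<Sum>b\<in>Basis. (nrm h \<bullet> b) * v (Inl b))" for h and v :: "'a + 'h \<times> bool \<Rightarrow> real"
  define f where "f v = (\<Prod>h\<in>H. of_bool (v (Inr (h, False)) < L h v) * of_bool (L h v \<le> v (Inr (h, True))) :: real)"
    for v :: "'a + 'h \<times> bool \<Rightarrow> real"
  have "affine_form (L h)" for h
    unfolding L_def by (intro affine_form_sum affine_form_scale affine_form_var)
  then have "pw_poly f"
    unfolding f_def by (intro pw_poly_prod pw_poly_mult pw_poly_less pw_poly_le affine_form_var)
  obtain g :: "('a + 'h \<times> bool \<Rightarrow> real) \<Rightarrow> real" where g: "pw_poly g" "\<forall>p. g (case_sum (\<lambda>_. 0) p) =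
      (\<integral>y. f (case_sum (\<lambda>b. if b \<in> Basis then y \<bullet> b else 0) p) * indicator (cbox (- r *\<^sub>R One) (r *\<^sub>R One)) y \<partial>lborel)"
    using pw_poly_integral_cbox[OF \<open>pw_poly f\<close> assms(3)] by (elim exE conjE)
  obtain G where G: "finite G" "\<And>v. range v \<subseteq> subgroup_generated C \<Longrightarrow> g v \<in> subgroup_generated G"
    using pw_poly_values[OF g(1) assms(2)] by blast
  show ?thesis
  proof (intro exI[of _ G] conjI allI impI G(1))
    fix l u :: "'h \<Rightarrow> real"
    assume lu: "\<forall>h\<in>H. l h \<in> subgroup_generated C \<and> u h \<in> subgroup_generated C"
    let ?S = "{y. \<forall>h\<in>H. l h < nrm h \<bullet> y \<and> nrm h \<bullet> y \<le> u h}"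
    let ?Q = "cbox (- r *\<^sub>R One) (r *\<^sub>R One) :: 'a set"
    \<comment> \<open>The default 0 outside \<open>H\<close> keeps every variable inside the group
      generated by \<open>C\<close>.\<close>
    define p where "p = (\<lambda>(h, upper). if h \<in> H then if upper then u h else l h else 0)"
    have S: "?S \<in> sets borel"
    proof -
      have "?S = (\<Inter>h\<in>H. {y. l h < nrm h \<bullet> y} \<inter> {y. nrm h \<bullet> y \<le> u h}) \<inter> UNIV" by auto
      also have "\<dots> \<in> sets borel"
      proof (cases "H = {}")
        case False
        have "{y. l h < nrm h \<bullet> y} \<inter> {y. nrm h \<bullet> y \<le> u h} \<in> sets borel" for h
          by (intro sets.Int borel_open borel_closed open_halfspace_gt closed_halfspace_le)
        with False show ?thesis using assms(1) by (intro sets.Int sets.finite_INT) auto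
      qed auto
      finally show ?thesis .
    qed
    have "f (case_sum (\<lambda>b. if b \<in> Basis then y \<bullet> b else 0) p) * indicator ?Q y = indicator (?S \<inter> ?Q) y" for y
    proof -
      have "L h (case_sum (\<lambda>b. if b \<in> Basis then y \<bullet> b else 0) p) = nrm h \<bullet> y" for h
        unfolding L_def euclidean_inner[of "nrm h" y] by (intro sum.cong) auto
      then have "f (case_sum (\<lambda>b. if b \<in> Basis then y \<bullet> b else 0) p) =
          (\<Prod>h\<in>H. of_bool (l h < nrm h \<bullet> y \<and> nrm h \<bullet> y \<le> u h))"
        unfolding f_def by (intro prod.cong) (auto simp: p_def)
      also have "\<dots> = indicator ?S y"
      proof (cases "y \<in> ?S")
        case True
        then show ?thesis by simp
      next
        case False
        then obtain h where "h \<in> H" "\<not> (l h < nrm h \<bullet> y \<and> nrm h \<bullet> y \<le> u h)" by blast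
        then have "(\<Prod>h\<in>H. of_bool (l h < nrm h \<bullet> y \<and> nrm h \<bullet> y \<le> u h) :: real) = 0"
          by (intro prod_zero assms(1) bexI[of _ h]) simp_all
        with False show ?thesis by simp
      qed
      finally show ?thesis by (simp add: indicator_inter_arith)
    qed
    then have "g (case_sum (\<lambda>_. 0) p) = (\<integral>y. indicator (?S \<inter> ?Q) y \<partial>lborel)"
      unfolding g(2)[rule_format] by simp
    also have "\<dots> = measure lborel (?S \<inter> ?Q)"
      using S by simp
    finally have "measure lborel (?S \<inter> ?Q) = g (case_sum (\<lambda>_. 0) p)" ..
    moreover have "range (case_sum (\<lambda>_. 0) p :: 'a + 'h \<times> bool \<Rightarrow> real) \<subseteq> subgroup_generated C"
      using lu add_subgroupD(1)[OF add_subgroup_subgroup_generated[of C]]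
      by (auto simp: p_def split: sum.split)
    ultimately show "measure lborel (?S \<inter> ?Q) \<in> subgroup_generated G" using G(2) by metis
  qed
qed

text \<open>The outcome of all comparisons with \<open>V\<close> is constant exactly between
  neighbouring elements of \<open>V\<close>; testing with \<open>\<le>\<close> makes these intervals
  open on the left and closed on the right. \<open>c0\<close> and \<open>c1\<close> guarantee a
  neighbour on each side.\<close>

lemma finite_cut_interval:
  fixes V :: "real set"
  assumes "finite V" "c0 \<in> V" "c0 < t" "c1 \<in> V" "t \<le> c1"
  shows "\<exists>l\<in>V. \<exists>u\<in>V. \<forall>s. (\<forall>c\<in>V. s \<le> c \<longleftrightarrow> t \<le> c) \<longleftrightarrow> l < s \<and> s \<le> u"
proof -
  let ?A = "{c\<in>V. c < t}" and ?B = "{c\<in>V. t \<le> c}"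
  have fin: "finite ?A" "finite ?B" "?A \<noteq> {}" "?B \<noteq> {}" using assms by auto
  note A = Max_in[OF fin(1,3)] Max_ge[OF fin(1)]
  note B = Min_in[OF fin(2,4)] Min_le[OF fin(2)]
  have "(\<forall>c\<in>V. s \<le> c \<longleftrightarrow> t \<le> c) \<longleftrightarrow> Max ?A < s \<and> s \<le> Min ?B" for s
  proof
    assume "\<forall>c\<in>V. s \<le> c \<longleftrightarrow> t \<le> c"
    then show "Max ?A < s \<and> s \<le> Min ?B" using A(1) B(1) by (metis (mono_tags, lifting) mem_Collect_eq not_le)
  next
    assume s: "Max ?A < s \<and> s \<le> Min ?B"
    show "\<forall>c\<in>V. s \<le> c \<longleftrightarrow> t \<le> c"
    proof
      fix c assume "c \<in> V"
      then show "s \<le> c \<longleftrightarrow> t \<le> c" using A(2)[of c] B(2)[of c] s by fastforce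
    qed
  qed
  then show ?thesis using A(1) B(1) by blast
qed

text \<open>By linearity the values on the lattice are integer combinations of the values on a
  basis. One finite \<open>B\<close> serves lattice vectors of any length, so larger patches
  introduce no new generators.\<close>

lemma lattice_inner_subgroup:
  fixes \<Gamma> :: "('a::euclidean_space \<times> 'b::euclidean_space) set"
  assumes "is_lattice \<Gamma>"
  shows "\<exists>B :: ('a \<times> 'b) set. finite B \<and> (\<forall>\<delta>\<in>\<Gamma>. \<forall>a. a \<bullet> snd \<delta> \<in> subgroup_generated ((\<lambda>\<beta>. a \<bullet> snd \<beta>) ` B))"
proof -
  obtain B where B: "independent B" and \<Gamma>: "\<Gamma> = {\<Sum>b\<in>B. of_int (c b) *\<^sub>R b | c. True}"
    using assms unfolding is_lattice_def by blast
  show ?thesis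
  proof (intro exI[of _ B] conjI ballI allI)
    fix a \<delta> assume "\<delta> \<in> \<Gamma>"
    then obtain c where "\<delta> = (\<Sum>b\<in>B. of_int (c b) *\<^sub>R b)" by (auto simp: \<Gamma>)
    then have "a \<bullet> snd \<delta> = (\<Sum>b\<in>B. of_int (c b) * (a \<bullet> snd b))"
      by (simp add: snd_sum inner_sum_right)
    also have "\<dots> \<in> subgroup_generated ((\<lambda>\<beta>. a \<bullet> snd \<beta>) ` B)"
      by (intro add_subgroup_sum add_subgroup_of_int_mult subgroup_generated_inc) auto
    finally show "a \<bullet> snd \<delta> \<in> subgroup_generated ((\<lambda>\<beta>. a \<bullet> snd \<beta>) ` B)" .
  qed (rule independent_imp_finite[OF B])
qed

text \<open>Everything up to \<open>G'\<close> is fixed before the radius and the patch; these only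
  decide which cells occur and which elements of the fixed group are their offsets.\<close>

lemma frequencies_finitely_generated:
  fixes \<Gamma> :: "('a::euclidean_space \<times> 'b::euclidean_space) set"
  assumes "is_lattice \<Gamma>" "inj_on fst \<Gamma>" "closure (snd ` \<Gamma>) = UNIV" "compact_polyhedron K"
  shows "\<exists>G. finite G \<and> frequencies (proj_pattern \<Gamma> K) \<subseteq> subgroup_generated G"
proof -
  obtain F where F: "F \<in> sets borel" "bounded F" "\<forall>x. \<exists>!\<gamma>\<in>\<Gamma>. x - \<gamma> \<in> F"
    using lattice_fundamental_domain[OF assms(1)] by (elim exE conjE)
  interpret model_set \<Gamma> F
    using assms F by unfold_locales blast+
  obtain H \<T> where H: "finite H" "\<forall>T\<in>\<T>. T \<subseteq> H"
    and K: "\<forall>y. y \<in> K \<longleftrightarrow> (\<exists>T\<in>\<T>. \<forall>h\<in>T. fst h \<bullet> y \<le> snd h)"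
    using compact_polyhedron_inequalities(2)[OF assms(4)] by (elim exE conjE)
  note bK = compact_polyhedron_inequalities(1)[OF assms(4)]
  obtain r0 where r0: "0 < r0" "\<And>y. y \<in> K \<Longrightarrow> norm y \<le> r0"
    using bK by (auto simp: bounded_pos)
  \<comment> \<open>A strict bound for all face functionals on \<open>K\<close>, strict because of
    the added 1. The numbers \<open>- M\<close> and \<open>M\<close> act as artificial outermost
    offsets, so every cell is bounded in each normal direction.\<close>
  define M where "M = r0 * (\<Sum>h\<in>H. norm (fst h)) + 1"
  have M: "\<bar>fst h \<bullet> y\<bar> < M" if "h \<in> H" "y \<in> K" for h y
  proof -
    have "\<bar>fst h \<bullet> y\<bar> \<le> norm (fst h) * norm y" by (rule Cauchy_Schwarz_ineq2)
    also have "\<dots> \<le> (\<Sum>h\<in>H. norm (fst h)) * r0"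
      using r0(2)[OF that(2)] member_le_sum[OF that(1), of "\<lambda>h. norm (fst h)"] H(1)
      by (intro mult_mono) (auto intro: sum_nonneg)
    finally show ?thesis by (simp add: M_def mult.commute)
  qed
  obtain B :: "('a \<times> 'b) set" where B: "finite B"
    "\<forall>\<delta>\<in>\<Gamma>. \<forall>a. a \<bullet> snd \<delta> \<in> subgroup_generated ((\<lambda>\<beta>. a \<bullet> snd \<beta>) ` B)"
    using lattice_inner_subgroup[OF assms(1)] by (elim exE conjE)
  \<comment> \<open>Every offset that can occur is \<open>M\<close>, \<open>- M\<close> or
    \<open>snd h - fst h \<bullet> snd \<delta>\<close>, and all of these are integer combinations
    of elements of \<open>C\<close>.\<close>
  define C where "C = insert M (snd ` H \<union> (\<lambda>(h, \<beta>). fst h \<bullet> snd \<beta>) ` (H \<times> B))"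
  have C: "finite C" using H(1) B(1) by (simp add: C_def)
  note genC = add_subgroupD[OF add_subgroup_subgroup_generated[of C]]
  have C_cut: "snd h - fst h \<bullet> snd \<delta> \<in> subgroup_generated C" if "h \<in> H" "\<delta> \<in> \<Gamma>" for h \<delta>
  proof (rule genC(4))
    show "snd h \<in> subgroup_generated C" using that by (intro subgroup_generated_inc) (auto simp: C_def)
    have "(\<lambda>\<beta>. fst h \<bullet> snd \<beta>) ` B \<subseteq> C" using that by (auto simp: C_def)
    then show "fst h \<bullet> snd \<delta> \<in> subgroup_generated C"
      using B(2)[rule_format, OF that(2)] subgroup_generated_mono by blast
  qed
  obtain G where G: "finite G"
    "\<forall>l u. (\<forall>h\<in>H. l h \<in> subgroup_generated C \<and> u h \<in> subgroup_generated C) \<longrightarrow>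
      measure lborel ({y. \<forall>h\<in>H. l h < fst h \<bullet> y \<and> fst h \<bullet> y \<le> u h} \<inter> cbox (- r0 *\<^sub>R One) (r0 *\<^sub>R One))
        \<in> subgroup_generated G"
    using slab_volume_finitely_generated[OF H(1) C less_imp_le[OF r0(1)], where nrm = fst] by (elim exE conjE)
  \<comment> \<open>Division by the covolume is applied to the generators.\<close>
  define G' where "G' = (\<lambda>(a, b). a * b) ` (G \<times> {1 / measure lborel F})"
  have "density (occurrences (proj_pattern \<Gamma> K) r P) \<in> subgroup_generated G'" if "0 \<le> r" for r P
  proof -
    \<comment> \<open>The lattice vectors that can join two pattern points at distance at most
      \<open>r\<close>: both internal coordinates lie in \<open>K\<close>, within \<open>r0\<close>
      of the origin, which gives \<open>2 * r0\<close>.\<close>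
    define D where "D = {\<delta>\<in>\<Gamma>. norm (fst \<delta>) \<le> r \<and> norm (snd \<delta>) \<le> 2 * r0}"
    \<comment> \<open>The acceptance domain: whether the patch occurs at \<open>fst \<gamma>\<close>
      depends on \<open>snd \<gamma>\<close> alone.\<close>
    define A where "A = {y\<in>K. fst ` {\<delta>\<in>\<Gamma>. norm (fst \<delta>) \<le> r \<and> y + snd \<delta> \<in> K} = P}"
    \<comment> \<open>\<open>y + snd \<delta>\<close> satisfies the inequality \<open>h\<close>
      exactly if \<open>fst h \<bullet> y \<le> snd h - fst h \<bullet> snd \<delta>\<close>. Hence
      \<open>sig y\<close> records which of the points \<open>y + snd \<delta>\<close> with
      \<open>\<delta> \<in> D\<close> lie in the window.\<close>
    define V where "V h = {M, - M} \<union> (\<lambda>\<delta>. snd h - fst h \<bullet> snd \<delta>) ` D" for h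
    define sig where "sig y = {(h, c). h \<in> H \<and> c \<in> V h \<and> fst h \<bullet> y \<le> c}" for y
    define cell where "cell s = {y. sig y = s}" for s
    have occ: "occurrences (proj_pattern \<Gamma> K) r P = fst ` {\<gamma>\<in>\<Gamma>. snd \<gamma> \<in> A}"
    proof -
      have patch: "(\<lambda>y. y - fst \<gamma>) ` proj_pattern \<Gamma> K \<inter> cball 0 r =
          fst ` {\<delta>\<in>\<Gamma>. norm (fst \<delta>) \<le> r \<and> snd \<gamma> + snd \<delta> \<in> K}" if "\<gamma> \<in> \<Gamma>" for \<gamma>
      proof (intro set_eqI iffI)
        fix x assume "x \<in> (\<lambda>y. y - fst \<gamma>) ` proj_pattern \<Gamma> K \<inter> cball 0 r"
        then obtain \<delta> where \<delta>: "\<delta> \<in> \<Gamma>" "snd \<delta> \<in> K" "x = fst (\<delta> - \<gamma>)" "norm x \<le> r"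
          by (auto simp: proj_pattern_def)
        then show "x \<in> fst ` {\<delta>\<in>\<Gamma>. norm (fst \<delta>) \<le> r \<and> snd \<gamma> + snd \<delta> \<in> K}"
          using lattice_closed(2)[OF assms(1) \<delta>(1) that] by (intro image_eqI[of _ _ "\<delta> - \<gamma>"]) auto
      next
        fix x assume "x \<in> fst ` {\<delta>\<in>\<Gamma>. norm (fst \<delta>) \<le> r \<and> snd \<gamma> + snd \<delta> \<in> K}"
        then obtain \<delta> where \<delta>: "\<delta> \<in> \<Gamma>" "snd (\<gamma> + \<delta>) \<in> K" "x = fst \<delta>" "norm x \<le> r" by auto
        then have "fst (\<gamma> + \<delta>) \<in> proj_pattern \<Gamma> K"
          using lattice_closed(1)[OF assms(1) that \<delta>(1)] unfolding proj_pattern_def by blast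
        moreover have "x = fst (\<gamma> + \<delta>) - fst \<gamma>" using \<delta>(3) by simp
        ultimately have "x \<in> (\<lambda>y. y - fst \<gamma>) ` proj_pattern \<Gamma> K" by blast
        then show "x \<in> (\<lambda>y. y - fst \<gamma>) ` proj_pattern \<Gamma> K \<inter> cball 0 r"
          using \<delta>(4) by simp
      qed
      have X: "t \<in> proj_pattern \<Gamma> K \<longleftrightarrow> (\<exists>\<gamma>\<in>\<Gamma>. snd \<gamma> \<in> K \<and> t = fst \<gamma>)" for t
        unfolding proj_pattern_def by blast
      have "occurrences (proj_pattern \<Gamma> K) r P =
          fst ` {\<gamma>\<in>\<Gamma>. snd \<gamma> \<in> K \<and> (\<lambda>y. y - fst \<gamma>) ` proj_pattern \<Gamma> K \<inter> cball 0 r = P}"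
        unfolding occurrences_def
        by (intro set_eqI) (simp only: mem_Collect_eq X image_iff, blast)
      also have "{\<gamma>\<in>\<Gamma>. snd \<gamma> \<in> K \<and> (\<lambda>y. y - fst \<gamma>) ` proj_pattern \<Gamma> K \<inter> cball 0 r = P} = {\<gamma>\<in>\<Gamma>. snd \<gamma> \<in> A}"
        unfolding A_def by (intro Collect_cong conj_cong refl) (simp add: patch)
      finally show ?thesis .
    qed
    have finD: "finite D"
      using finite_bounded_Int[of "cball 0 r \<times> cball 0 (2 * r0)"]
      by (simp add: bounded_Times D_def mem_Times_iff Int_def)
    \<comment> \<open>The zero vector in \<open>D\<close> makes the signature decide membership in
      \<open>K\<close> itself.\<close>
    have zeroD: "0 \<in> D" if "y \<in> K" for y
    proof -
      have "\<Gamma> \<noteq> {}" using F(3) by blast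
      then have "0 \<in> \<Gamma>" using lattice_closed(3)[OF assms(1)] by blast
      then show ?thesis using \<open>0 \<le> r\<close> r0(1) by (simp add: D_def)
    qed
    have finV: "finite (V h)" for h using finD by (simp add: V_def)
    have VC: "c \<in> subgroup_generated C" if "h \<in> H" "c \<in> V h" for h c
    proof -
      have "M \<in> subgroup_generated C" by (intro subgroup_generated_inc) (simp add: C_def)
      then show ?thesis using that genC(3) C_cut by (auto simp: V_def D_def)
    qed
    have sig_iff: "fst h \<bullet> y \<le> c \<longleftrightarrow> fst h \<bullet> z \<le> c" if "sig y = sig z" "h \<in> H" "c \<in> V h" for y z h c
      using that unfolding sig_def set_eq_iff by blast
    have sig_K: "y + snd \<delta> \<in> K \<longleftrightarrow> z + snd \<delta> \<in> K" if "sig y = sig z" "\<delta> \<in> D" for y z \<delta>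
    proof -
      have "fst h \<bullet> (y + snd \<delta>) \<le> snd h \<longleftrightarrow> fst h \<bullet> (z + snd \<delta>) \<le> snd h" if "h \<in> H" for h
        using sig_iff[OF \<open>sig y = sig z\<close> that, of "snd h - fst h \<bullet> snd \<delta>"] \<open>\<delta> \<in> D\<close>
        by (simp add: V_def inner_add_right algebra_simps)
      then show ?thesis unfolding K[rule_format] using H(2) by (meson subsetD)
    qed
    have near: "\<delta> \<in> D" if "y \<in> K" "\<delta> \<in> \<Gamma>" "norm (fst \<delta>) \<le> r" "y + snd \<delta> \<in> K" for y \<delta>
      using that r0(2)[OF that(1)] r0(2)[OF that(4)] norm_triangle_ineq4[of "y + snd \<delta>" y] by (simp add: D_def)
    \<comment> \<open>Once \<open>y\<close> and \<open>z\<close> are both in \<open>K\<close>, only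
      vectors of \<open>D\<close> contribute to their patches, so equal signatures give equal
      patches and \<open>A\<close> is a union of cells.\<close>
    have sig_A: "z \<in> A" if "y \<in> A" "sig y = sig z" for y z
    proof -
      have y: "y \<in> K" using that by (simp add: A_def)
      then have z: "z \<in> K" using sig_K[OF that(2) zeroD[OF y]] by simp
      have "{\<delta>\<in>\<Gamma>. norm (fst \<delta>) \<le> r \<and> y + snd \<delta> \<in> K} = {\<delta>\<in>\<Gamma>. norm (fst \<delta>) \<le> r \<and> z + snd \<delta> \<in> K}"
        using near[OF y] near[OF z] sig_K[OF that(2)] by blast
      then show ?thesis using that(1) z by (simp add: A_def)
    qed
    have finS: "finite (sig ` A)"
    proof (rule finite_subset)
      show "sig ` A \<subseteq> Pow (Sigma H V)" by (auto simp: sig_def)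
      show "finite (Pow (Sigma H V))" using H(1) finV by auto
    qed
    have cell: "bounded (cell s) \<and> negligible (frontier (cell s)) \<and> measure lebesgue (cell s) \<in> subgroup_generated G"
      if s: "s \<in> sig ` A" for s
    proof -
      obtain y where y: "y \<in> A" "s = sig y" using s by blast
      have yK: "y \<in> K" using y by (simp add: A_def)
      have sub: "cell s \<subseteq> K" using sig_A[OF y(1)] y(2) by (auto simp: cell_def A_def)
      define cuts where "cuts h l u \<longleftrightarrow> (\<forall>t. (\<forall>c\<in>V h. t \<le> c \<longleftrightarrow> fst h \<bullet> y \<le> c) \<longleftrightarrow> l < t \<and> t \<le> u)" for h l u
      have "\<exists>l\<in>V h. \<exists>u\<in>V h. cuts h l u" if "h \<in> H" for h
        unfolding cuts_def using finV M[OF that yK]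
        by (intro finite_cut_interval[of _ "- M" _ M]) (auto simp: V_def)
      then obtain l u where lu: "\<And>h. h \<in> H \<Longrightarrow> l h \<in> V h" "\<And>h. h \<in> H \<Longrightarrow> u h \<in> V h"
        "\<And>h. h \<in> H \<Longrightarrow> cuts h (l h) (u h)" by metis
      let ?S = "{z. \<forall>h\<in>H. l h < fst h \<bullet> z \<and> fst h \<bullet> z \<le> u h}"
      have "sig z = sig y \<longleftrightarrow> (\<forall>h\<in>H. \<forall>c\<in>V h. fst h \<bullet> z \<le> c \<longleftrightarrow> fst h \<bullet> y \<le> c)" for z
      proof
        show "sig z = sig y \<Longrightarrow> \<forall>h\<in>H. \<forall>c\<in>V h. fst h \<bullet> z \<le> c \<longleftrightarrow> fst h \<bullet> y \<le> c"
          by (intro ballI sig_iff)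
      qed (auto simp: sig_def)
      then have eq: "cell s = ?S" unfolding cell_def y(2) using lu(3) by (auto simp: cuts_def)
      have "cell s \<subseteq> cbox (- r0 *\<^sub>R One) (r0 *\<^sub>R One)"
      proof
        fix z assume "z \<in> cell s"
        then have "norm z \<le> r0" using sub r0(2) by blast
        then have "\<bar>z \<bullet> b\<bar> \<le> r0" if "b \<in> Basis" for b using Basis_le_norm[OF that, of z] by linarith
        then show "z \<in> cbox (- r0 *\<^sub>R One) (r0 *\<^sub>R One)" by (fastforce simp: mem_box abs_le_iff)
      qed
      \<comment> \<open>The box cuts nothing off; it only provides the bounded region of integration
        for the volume function.\<close>
      then have "cell s = ?S \<inter> cbox (- r0 *\<^sub>R One) (r0 *\<^sub>R One)" using eq by blast
      moreover have "\<forall>h\<in>H. l h \<in> subgroup_generated C \<and> u h \<in> subgroup_generated C"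
        using lu(1,2) VC by blast
      ultimately have vol: "measure lborel (cell s) \<in> subgroup_generated G" using G(2) by simp
      have S: "?S = (\<Inter>h\<in>H. {z. l h < fst h \<bullet> z} \<inter> {z. fst h \<bullet> z \<le> u h})" by auto
      have "convex (cell s)"
        unfolding eq S by (intro convex_INT convex_Int convex_halfspace_gt convex_halfspace_le)
      moreover have "cell s \<in> sets borel"
      proof (cases "H = {}")
        case False
        have "{z. l h < fst h \<bullet> z} \<inter> {z. fst h \<bullet> z \<le> u h} \<in> sets borel" for h
          by (intro sets.Int borel_open borel_closed open_halfspace_gt closed_halfspace_le)
        with False show ?thesis unfolding eq S using H(1) by (intro sets.finite_INT) auto
      qed (simp add: eq)
      then have "measure lebesgue (cell s) = measure lborel (cell s)" by (simp add: measure_completion)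
      ultimately show ?thesis
        using vol bounded_subset[OF bK sub] negligible_convex_frontier by metis
    qed
    have A_cells: "A = (\<Union>s\<in>sig ` A. cell s)" using sig_A by (auto simp: cell_def)
    \<comment> \<open>Injectivity of \<open>fst\<close> on \<open>\<Gamma>\<close> turns occurrences
      into lattice points, and cells of different signatures are disjoint, so the counts add up
      exactly.\<close>
    have card: "card (occurrences (proj_pattern \<Gamma> K) r P \<inter> ball 0 R) = (\<Sum>s\<in>sig ` A. card (strip (cell s) R))" for R
    proof -
      have "occurrences (proj_pattern \<Gamma> K) r P \<inter> ball 0 R = fst ` strip A R"
        unfolding occ strip_def by auto
      moreover have "inj_on fst (strip A R)" using assms(2) by (rule inj_on_subset) (auto simp: strip_def)
      ultimately have "card (occurrences (proj_pattern \<Gamma> K) r P \<inter> ball 0 R) = card (strip A R)"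
        by (simp add: card_image)
      also have "strip A R = (\<Union>s\<in>sig ` A. strip (cell s) R)"
        using A_cells by (auto simp: strip_def)
      also have "card \<dots> = (\<Sum>s\<in>sig ` A. card (strip (cell s) R))"
      proof (rule card_UN_disjoint[OF finS])
        show "\<forall>s\<in>sig ` A. finite (strip (cell s) R)" using cell finite_strip by blast
        show "\<forall>s\<in>sig ` A. \<forall>s'\<in>sig ` A. s \<noteq> s' \<longrightarrow> strip (cell s) R \<inter> strip (cell s') R = {}"
          unfolding strip_def cell_def by blast
      qed
      finally show ?thesis .
    qed
    have "((\<lambda>R. \<Sum>s\<in>sig ` A. card (strip (cell s) R) / measure lborel (ball (0::'a) R)) \<longlongrightarrow>
        (\<Sum>s\<in>sig ` A. measure lebesgue (cell s) / measure lborel F)) at_top"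
      using cell by (intro tendsto_sum strip_density) auto
    then have "density (occurrences (proj_pattern \<Gamma> K) r P) = (\<Sum>s\<in>sig ` A. measure lebesgue (cell s) / measure lborel F)"
      unfolding density_def card of_nat_sum sum_divide_distrib by (intro tendsto_Lim) auto
    also have "\<dots> \<in> subgroup_generated G'"
    proof (intro add_subgroup_sum add_subgroup_subgroup_generated)
      fix s assume "s \<in> sig ` A"
      then have "measure lebesgue (cell s) * (1 / measure lborel F) \<in> subgroup_generated G'"
        unfolding G'_def using cell by (intro subgroup_generated_mult subgroup_generated_inc[of _ "{_}"]) auto
      then show "measure lebesgue (cell s) / measure lborel F \<in> subgroup_generated G'" by simp
    qed
    finally show ?thesis .
  qed
  moreover have "finite G'" using G(1) by (simp add: G'_def)
  ultimately show ?thesis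
    by (intro exI[of _ G']) (auto simp: frequencies_def patches_def)
qed

theorem theorem9:
  fixes \<Gamma> :: "((real^'n) \<times> (real^'m)) set" and K :: "(real^'m) set"
  assumes "almost_canonical \<Gamma> K"
  shows "finitely_generated (freq_module (proj_pattern \<Gamma> K))"
proof -
  from assms have "is_lattice \<Gamma>" "inj_on fst \<Gamma>" "closure (snd ` \<Gamma>) = UNIV" "compact_polyhedron K"
    unfolding almost_canonical_def by blast+
  from frequencies_finitely_generated[OF this] obtain G where
    "finite G" "frequencies (proj_pattern \<Gamma> K) \<subseteq> subgroup_generated G" by blast
  \<comment> \<open>The generators in \<open>G\<close> need not be frequencies; the Noetherian
    property supplies generators of the frequency module itself.\<close>
  then show ?thesis
    unfolding freq_module_def
    by (intro subgroup_of_finitely_generated[of G] subgroup_generated_minimal) auto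
qed

end
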